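(* For any constant $k\ge 1$, there is an online algorithm with competitive ratio at most $\frac{1000k(k+1)}{9}$ for the submodular matroid secretary problem in which the feasible sets are the intersection of $k$ laminar matroids. That is, for every family of $k$ laminar matroids $(U,\mathcal{I}_1),\dots,(U,\mathcal{I}_k)$ on a common ground set and every non-negative, monotonically non-decreasing submodular $f$, the accepted set $\mathrm{ALG}$ always lies in $\mathcal{I}_1\cap\dots\cap\mathcal{I}_k$ and $\mathbb{E}[f(\mathrm{ALG})]\ge \frac{9}{1000k(k+1)}\max_{T\in\mathcal{I}_1\cap\cdots\cap\mathcal{I}_k}f(T)$.
   Context: Online setting: $U$ is a finite ground set; the independence system $\mathcal{I}=\mathcal{I}_1\cap\dots\cap\mathcal{I}_k$ is known to the algorithm. An adversary fixes a non-negative, monotonically non-decreasing submodular $f:2^U\to\mathbb{R}_{\ge0}$ ($f(S)+f(T)\ge f(S\cup T)+f(S\cap T)$). Elements arrive one by one in uniformly random order; the algorithm can query $f$ only on sets of already-arrived elements; upon arrival of an element it must irrevocably accept or reject it; the accepted set must always be in $\mathcal{I}$. Competitive ratio at most $C$ means $\mathbb{E}[f(\mathrm{ALG})]\ge \frac1C\max_{T\in\mathcal{I}}f(T)$ for every $f$, expectation over the random order and the algorithm's randomness. Laminar matroid: given a laminar family $\mathcal{F}$ of subsets of $U$ (any two members are disjoint or nested) with integer capacities $\mu(B)$, $B\in\mathcal{F}$, the independent sets are the $T\subseteq U$ with $|T\cap B|\le\mu(B)$ for all $B\in\mathcal{F}$. *)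

theory Defs
  imports "HOL-Probability.Probability" "HOL-Combinatorics.Multiset_Permutations"
begin

definition laminar_family :: "'a set \<Rightarrow> 'a set set \<Rightarrow> bool" where
  "laminar_family U F \<longleftrightarrow> (\<forall>B\<in>F. B \<subseteq> U) \<and>
     (\<forall>B\<in>F. \<forall>C\<in>F. B \<inter> C = {} \<or> B \<subseteq> C \<or> C \<subseteq> B)"

definition laminar_indep :: "'a set \<Rightarrow> 'a set set \<Rightarrow> ('a set \<Rightarrow> nat) \<Rightarrow> 'a set \<Rightarrow> bool" where
  "laminar_indep U F mu T \<longleftrightarrow> T \<subseteq> U \<and> (\<forall>B\<in>F. card (T \<inter> B) \<le> mu B)"

definition mono_submod :: "'a set \<Rightarrow> ('a set \<Rightarrow> real) \<Rightarrow> bool" where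
  "mono_submod U f \<longleftrightarrow>
     (\<forall>S. S \<subseteq> U \<longrightarrow> f S \<ge> 0) \<and>
     (\<forall>S T. S \<subseteq> T \<and> T \<subseteq> U \<longrightarrow> f S \<le> f T) \<and>
     (\<forall>S T. S \<subseteq> U \<and> T \<subseteq> U \<longrightarrow> f S + f T \<ge> f (S \<union> T) + f (S \<inter> T))"

text \<open>Value oracle restricted to sets of already-arrived elements A
  (queries on other sets give no information).\<close>
definition restrict_oracle :: "('a set \<Rightarrow> real) \<Rightarrow> 'a set \<Rightarrow> 'a set \<Rightarrow> real" where
  "restrict_oracle f A = (\<lambda>S. if S \<subseteq> A then f S else 0)"

text \<open>A deterministic online algorithm is a decision rule d: when the i-th element
  arrives, it sees the arrival sequence so far (the current element last) and the oracle
  restricted to subsets of arrived elements, and decides accept (True) / reject.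
  (Its earlier decisions are recomputable from the same data.)
  The set accepted when the elements arrive in order sigma:\<close>
definition accepted :: "('a list \<Rightarrow> ('a set \<Rightarrow> real) \<Rightarrow> bool) \<Rightarrow> ('a set \<Rightarrow> real) \<Rightarrow> 'a list \<Rightarrow> 'a set" where
  "accepted d f \<sigma> = {\<sigma> ! i | i. i < length \<sigma> \<and>
      d (take (Suc i) \<sigma>) (restrict_oracle f (set (take (Suc i) \<sigma>)))}"

end

theory Submission
  imports Defs
begin

text \<open>
  The first \<open>Bin(n, p)\<close> arrivals form a sample \<open>S\<close> in which each element lies independently with
  probability \<open>p = 1 - 1/(50k)\<close>. Run greedy on \<open>U\<close>, always taking the eligible element of largest
  marginal value over the current set \<open>M\<close>; by tossing a coin for it (is it in \<open>S\<close>?) it either joins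
  \<open>M\<close> (heads) or a set \<open>N\<close> (tails), which leaves \<open>M\<close> unchanged. Whether a later arrival belongs to
  \<open>N\<close> depends only on \<open>S\<close> and that element, so the algorithm can accept the elements of \<open>N\<close> as they
  arrive, whenever feasibility permits.

  Intersections of \<open>k\<close> laminar matroids have the \<open>k\<close>-exchange property, hence
  \<open>E f(M) - f({})\<close> is at least \<open>1/(k+1)\<close> times \<open>OPT - f({})\<close>. Measuring tails by their marginal value
  over everything processed before gives \<open>N\<close> an expected value of at least
  \<open>(1 - p) (E f(M) - f({}))\<close>. Finally, the elements of \<open>N\<close> rejected because of a set \<open>B\<close> of capacity
  \<open>m\<close> number at most \<open>|N \<inter> B| - m\<close>, and since marginals decrease along the run each is worth at most
  the first processed element of \<open>B\<close>. As the run has at most \<open>m\<close> heads in \<open>B\<close>, an exponential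
  supermartingale bounds the expected excess of tails by \<open>O((1 - p)^(m + 1))\<close>, and the
  capacities along a chain may be taken distinct, so these losses form a geometric series.
\<close>

subsection \<open>Monotone submodular functions\<close>

lemma mono_submodD:
  assumes "mono_submod U f"
  shows "S \<subseteq> U \<Longrightarrow> 0 \<le> f S"
    and "S \<subseteq> T \<Longrightarrow> T \<subseteq> U \<Longrightarrow> f S \<le> f T"
    and "S \<subseteq> U \<Longrightarrow> T \<subseteq> U \<Longrightarrow> f (S \<union> T) + f (S \<inter> T) \<le> f S + f T"
  using assms unfolding mono_submod_def by blast+

text \<open>For \<open>u\<close> in \<open>T\<close> the left side vanishes and monotonicity makes
  the right side nonnegative; otherwise this is submodularity for \<open>insert u S\<close> and
  \<open>T\<close>.\<close>

lemma mono_submod_marginal_antimono: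
  assumes f: "mono_submod U f" and "S \<subseteq> T" "T \<subseteq> U" "u \<in> U"
  shows "f (insert u T) - f T \<le> f (insert u S) - f S"
proof (cases "u \<in> T")
  case True
  then show ?thesis
    using mono_submodD(2)[OF f, of S "insert u S"] assms by (simp add: insert_absorb subset_insertI)
next
  case False
  have "insert u S \<union> T = insert u T" "insert u S \<inter> T = S" using assms False by auto
  then show ?thesis using mono_submodD(3)[OF f, of "insert u S" T] assms by (simp add: order.trans[OF assms(2,3)])
qed

lemma mono_submod_union_le:
  assumes f: "mono_submod U f" and "finite X" "X \<subseteq> U" "M \<subseteq> A" "A \<subseteq> U"
  shows "f (A \<union> X) \<le> f A + (\<Sum>t\<in>X. f (insert t M) - f M)"
  using assms(2,3)
proof (induction X rule: finite_induct)
  case (insert t X)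
  have "f (insert t (A \<union> X)) - f (A \<union> X) \<le> f (insert t M) - f M"
    using assms insert.prems by (intro mono_submod_marginal_antimono[OF f]) auto
  then show ?case using insert by simp
qed simp

subsection \<open>Independent sampling by a random prefix\<close>

text \<open>The expectation of \<open>g S\<close> when \<open>S\<close> contains each element of
  \<open>R\<close> independently with probability \<open>p\<close>, written as a finite sum.\<close>

definition bernoulli_sum :: "real \<Rightarrow> 'a set \<Rightarrow> ('a set \<Rightarrow> real) \<Rightarrow> real" where
  "bernoulli_sum p R g = (\<Sum>S\<in>Pow R. p ^ card S * (1 - p) ^ card (R - S) * g S)"

lemma bernoulli_sum_cong:
  assumes "\<And>S. S \<subseteq> R \<Longrightarrow> g S = h S"
  shows "bernoulli_sum p R g = bernoulli_sum p R h"
  unfolding bernoulli_sum_def using assms by (intro sum.cong) auto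

lemma bernoulli_sum_mono:
  assumes "0 \<le> p" "p \<le> 1" "\<And>S. S \<subseteq> R \<Longrightarrow> g S \<le> h S"
  shows "bernoulli_sum p R g \<le> bernoulli_sum p R h"
  unfolding bernoulli_sum_def using assms by (intro sum_mono mult_left_mono) auto

lemma bernoulli_sum_add:
  "bernoulli_sum p R (\<lambda>S. g S + h S) = bernoulli_sum p R g + bernoulli_sum p R h"
  unfolding bernoulli_sum_def by (simp add: algebra_simps sum.distrib)

lemma bernoulli_sum_cmult:
  "bernoulli_sum p R (\<lambda>S. c * g S) = c * bernoulli_sum p R g"
  unfolding bernoulli_sum_def by (simp add: algebra_simps sum_distrib_left)

lemma bernoulli_sum_diff:
  "bernoulli_sum p R (\<lambda>S. g S - h S) = bernoulli_sum p R g - bernoulli_sum p R h"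
  unfolding bernoulli_sum_def by (simp add: algebra_simps sum_subtractf)

lemma bernoulli_sum_sum:
  "bernoulli_sum p R (\<lambda>S. \<Sum>i\<in>A. g i S) = (\<Sum>i\<in>A. bernoulli_sum p R (g i))"
  unfolding bernoulli_sum_def sum_distrib_left by (rule sum.swap)

text \<open>Conditioning on the coin of \<open>u\<close>: the subsets of \<open>R\<close> split into
  those with and those without \<open>u\<close>.\<close>

lemma bernoulli_sum_remove:
  assumes "finite R" "u \<in> R"
  shows "bernoulli_sum p R g =
    p * bernoulli_sum p (R - {u}) (\<lambda>S. g (insert u S)) + (1 - p) * bernoulli_sum p (R - {u}) g"
proof -
  define R' where "R' = R - {u}"
  have R: "R = insert u R'" and u: "u \<notin> R'" and fin: "finite R'"
    using assms by (auto simp: R'_def)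
  let ?t = "\<lambda>S. p ^ card S * (1 - p) ^ card (R - S) * g S"
  have inj: "inj_on (insert u) (Pow R')"
    using u by (intro inj_onI) (metis PowD insert_ident subsetD)
  have "bernoulli_sum p R g = sum ?t (Pow R') + sum ?t (insert u ` Pow R')"
    unfolding bernoulli_sum_def unfolding R Pow_insert
    by (rule sum.union_disjoint) (use fin u in auto)
  also have "sum ?t (Pow R') = (1 - p) * bernoulli_sum p R' g"
    unfolding bernoulli_sum_def sum_distrib_left
  proof (rule sum.cong[OF refl])
    fix S assume "S \<in> Pow R'"
    then have "R - S = insert u (R' - S)" "u \<notin> R' - S" "finite (R' - S)" using u R fin by auto
    then show "?t S = (1 - p) * (p ^ card S * (1 - p) ^ card (R' - S) * g S)" by simp
  qed
  also have "sum ?t (insert u ` Pow R') = p * bernoulli_sum p R' (\<lambda>S. g (insert u S))"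
    unfolding bernoulli_sum_def sum_distrib_left sum.reindex[OF inj]
  proof (rule sum.cong[OF refl])
    fix S assume S: "S \<in> Pow R'"
    then have "R - insert u S = R' - S" "u \<notin> S" "finite S"
      using u R fin by (auto intro: finite_subset)
    then show "(?t \<circ> insert u) S =
        p * (p ^ card S * (1 - p) ^ card (R' - S) * g (insert u S))" by simp
  qed
  finally show ?thesis by (simp add: R'_def)
qed

lemma bernoulli_sum_const:
  assumes "finite R"
  shows "bernoulli_sum p R (\<lambda>_. c) = c"
  using assms
proof (induction R rule: finite_induct)
  case (insert u R)
  then show ?case
    by (subst bernoulli_sum_remove[of _ u]) (auto simp: algebra_simps)
qed (simp add: bernoulli_sum_def)

text \<open>Cutting at position \<open>card S\<close> is a bijection onto pairs of an ordering of
  \<open>S\<close> and an ordering of \<open>U - S\<close>.\<close>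

lemma card_permutations_take_eq:
  assumes "finite U" "S \<subseteq> U"
  shows "card {\<sigma> \<in> permutations_of_set U. set (take (card S) \<sigma>) = S} =
    fact (card S) * fact (card (U - S))"
proof -
  have fin: "finite S" "finite (U - S)" using assms finite_subset by auto
  have "bij_betw (\<lambda>(xs, ys). xs @ ys) (permutations_of_set S \<times> permutations_of_set (U - S))
      {\<sigma> \<in> permutations_of_set U. set (take (card S) \<sigma>) = S}"
  proof (rule bij_betwI[where g = "\<lambda>\<sigma>. (take (card S) \<sigma>, drop (card S) \<sigma>)"])
    show "(\<lambda>(xs, ys). xs @ ys) \<in> permutations_of_set S \<times> permutations_of_set (U - S) \<rightarrow>
        {\<sigma> \<in> permutations_of_set U. set (take (card S) \<sigma>) = S}"
      using assms by (auto simp: permutations_of_set_def distinct_card)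
    show "(\<lambda>\<sigma>. (take (card S) \<sigma>, drop (card S) \<sigma>)) \<in>
        {\<sigma> \<in> permutations_of_set U. set (take (card S) \<sigma>) = S} \<rightarrow>
        permutations_of_set S \<times> permutations_of_set (U - S)"
    proof
      fix \<sigma> assume "\<sigma> \<in> {\<sigma> \<in> permutations_of_set U. set (take (card S) \<sigma>) = S}"
      then have \<sigma>: "set \<sigma> = U" "distinct \<sigma>" "set (take (card S) \<sigma>) = S"
        by (auto simp: permutations_of_set_def)
      have "set \<sigma> = set (take (card S) \<sigma>) \<union> set (drop (card S) \<sigma>)"
        by (metis append_take_drop_id set_append)
      moreover have "set (take (card S) \<sigma>) \<inter> set (drop (card S) \<sigma>) = {}"
        using \<sigma>(2) by (simp add: set_take_disj_set_drop_if_distinct)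
      ultimately show "(take (card S) \<sigma>, drop (card S) \<sigma>) \<in>
          permutations_of_set S \<times> permutations_of_set (U - S)"
        using \<sigma> by (auto simp: permutations_of_set_def)
    qed
  qed (auto simp: permutations_of_set_def distinct_card)
  from bij_betw_same_card[OF this] show ?thesis
    using fin by (simp add: card_cartesian_product card_permutations_of_set)
qed

text \<open>Given its length \<open>m\<close>, the prefix is a uniformly random
  \<open>m\<close>-subset. The binomial coefficient in the law of \<open>m\<close> cancels the
  number of such subsets, which leaves the product weights of independent coins.\<close>

lemma expectation_binomial_prefix:
  fixes g :: "'a set \<Rightarrow> real"
  assumes fin: "finite U" and p: "0 \<le> p" "p \<le> 1"
  shows "measure_pmf.expectation
      (pair_pmf (binomial_pmf (card U) p) (pmf_of_set (permutations_of_set U)))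
      (\<lambda>(m, \<sigma>). g (set (take m \<sigma>))) = bernoulli_sum p U g"
proof -
  let ?n = "card U" and ?\<Pi> = "permutations_of_set U"
  let ?b = "\<lambda>m. pmf (binomial_pmf ?n p) m"
  have fP: "finite ?\<Pi>" "?\<Pi> \<noteq> {}" and cP: "card ?\<Pi> = fact ?n"
    using fin by (auto simp: card_permutations_of_set)
  have setb: "set_pmf (binomial_pmf ?n p) \<subseteq> {..?n}"
    using p by (auto simp: set_pmf_binomial_eq split: if_splits)
  have "measure_pmf.expectation (pair_pmf (binomial_pmf ?n p) (pmf_of_set ?\<Pi>))
      (\<lambda>(m, \<sigma>). g (set (take m \<sigma>))) =
      (\<Sum>x\<in>{..?n} \<times> ?\<Pi>. (case x of (m, \<sigma>) \<Rightarrow> g (set (take m \<sigma>))) *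
        pmf (pair_pmf (binomial_pmf ?n p) (pmf_of_set ?\<Pi>)) x)"
    by (rule integral_measure_pmf_real) (use fP setb in auto)
  also have "\<dots> = (\<Sum>m\<le>?n. \<Sum>\<sigma>\<in>?\<Pi>. g (set (take m \<sigma>)) * (?b m / fact ?n))"
    unfolding sum.cartesian_product
    by (rule sum.cong) (use fP cP in \<open>auto simp: pmf_pair\<close>)
  also have "\<dots> = (\<Sum>m\<le>?n. \<Sum>S | S \<subseteq> U \<and> card S = m.
      p ^ card S * (1 - p) ^ card (U - S) * g S)"
  proof (rule sum.cong[OF refl])
    fix m assume m: "m \<in> {..?n}"
    let ?\<S> = "{S. S \<subseteq> U \<and> card S = m}"
    have sub: "(\<lambda>\<sigma>. set (take m \<sigma>)) ` ?\<Pi> \<subseteq> ?\<S>"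
      using m by (auto simp: permutations_of_set_def distinct_card dest: in_set_takeD)
    have "(\<Sum>\<sigma>\<in>?\<Pi>. g (set (take m \<sigma>)) * (?b m / fact ?n)) =
        (\<Sum>S\<in>?\<S>. \<Sum>\<sigma> | \<sigma> \<in> ?\<Pi> \<and> set (take m \<sigma>) = S. g (set (take m \<sigma>)) * (?b m / fact ?n))"
      by (rule sum.group[symmetric]) (use fP fin sub in auto)
    also have "\<dots> = (\<Sum>S\<in>?\<S>. p ^ card S * (1 - p) ^ card (U - S) * g S)"
    proof (rule sum.cong[OF refl])
      fix S assume "S \<in> ?\<S>"
      then have S: "S \<subseteq> U" "card S = m" by auto
      have c: "card (U - S) = ?n - m" using S fin by (simp add: card_Diff_subset finite_subset)
      have "(\<Sum>\<sigma> | \<sigma> \<in> ?\<Pi> \<and> set (take m \<sigma>) = S. g (set (take m \<sigma>)) * (?b m / fact ?n)) =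
          (\<Sum>\<sigma> | \<sigma> \<in> ?\<Pi> \<and> set (take m \<sigma>) = S. g S * (?b m / fact ?n))"
        by (rule sum.cong) auto
      also have "\<dots> = fact m * fact (?n - m) * (g S * (?b m / fact ?n))"
        using card_permutations_take_eq[OF fin S(1)] S(2) c by simp
      also have "\<dots> = p ^ card S * (1 - p) ^ card (U - S) * g S"
        using p m S c by (simp add: binomial_fact)
      finally show "(\<Sum>\<sigma> | \<sigma> \<in> ?\<Pi> \<and> set (take m \<sigma>) = S. g (set (take m \<sigma>)) * (?b m / fact ?n)) =
          p ^ card S * (1 - p) ^ card (U - S) * g S" .
    qed
    finally show "(\<Sum>\<sigma>\<in>?\<Pi>. g (set (take m \<sigma>)) * (?b m / fact ?n)) =
        (\<Sum>S\<in>?\<S>. p ^ card S * (1 - p) ^ card (U - S) * g S)" .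
  qed
  also have "\<dots> = (\<Sum>m\<le>?n. \<Sum>S | S \<in> Pow U \<and> card S = m.
      p ^ card S * (1 - p) ^ card (U - S) * g S)"
    by simp
  also have "\<dots> = bernoulli_sum p U g"
    unfolding bernoulli_sum_def
    by (rule sum.group) (use fin card_mono in auto)
  finally show ?thesis .
qed

subsection \<open>The simulated greedy process\<close>

text \<open>\<open>base\<close> and \<open>remaining\<close> are the state just before
  \<open>elem\<close> is processed, so \<open>elem\<close> still belongs to
  \<open>remaining\<close>.\<close>

datatype 'a step = Step (base: "'a set") (remaining: "'a set") (elem: 'a) (heads: bool)

locale simulated_greedy =
  fixes I :: "'a set \<Rightarrow> bool" and rank :: "'a \<Rightarrow> nat"
begin

definition eligible :: "'a set \<Rightarrow> 'a set \<Rightarrow> 'a set" where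
  "eligible M R = {u \<in> R. I (insert u M)}"

text \<open>Ties are broken by \<open>rank\<close>. If it is injective, the best candidate is unique
  and stays the same when other candidates are removed.\<close>

definition is_best :: "('a set \<Rightarrow> real) \<Rightarrow> 'a set \<Rightarrow> 'a set \<Rightarrow> 'a \<Rightarrow> bool" where
  "is_best f M E u \<longleftrightarrow> u \<in> E \<and> (\<forall>v\<in>E. f (insert v M) < f (insert u M) \<or>
     f (insert v M) = f (insert u M) \<and> rank u \<le> rank v)"

definition best :: "('a set \<Rightarrow> real) \<Rightarrow> 'a set \<Rightarrow> 'a set \<Rightarrow> 'a" where
  "best f M R = (SOME u. is_best f M (eligible M R) u)"

lemma is_best_exists:
  assumes "finite E" "E \<noteq> {}"
  shows "\<exists>u. is_best f M E u"
proof -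
  define E' where "E' = {u \<in> E. \<forall>v\<in>E. f (insert v M) \<le> f (insert u M)}"
  have "finite ((\<lambda>v. f (insert v M)) ` E)" "(\<lambda>v. f (insert v M)) ` E \<noteq> {}" using assms by auto
  from Max_in[OF this] Max_ge[OF this(1)] have "E' \<noteq> {}" by (fastforce simp: E'_def)
  then obtain u where "u \<in> E'" "\<And>v. v \<in> E' \<Longrightarrow> rank u \<le> rank v"
    using ex_has_least_nat[of "\<lambda>u. u \<in> E'" _ rank] by blast
  then have "is_best f M E u" unfolding is_best_def E'_def by (force simp: not_less)
  then show ?thesis ..
qed

lemma best_is_best:
  assumes "finite R" "eligible M R \<noteq> {}"
  shows "is_best f M (eligible M R) (best f M R)"
  unfolding best_def
  by (rule someI_ex, rule is_best_exists) (use assms in \<open>auto simp: eligible_def\<close>)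

lemma best_in:
  assumes "finite R" "eligible M R \<noteq> {}"
  shows "best f M R \<in> eligible M R" "best f M R \<in> R"
  using best_is_best[OF assms, of f] by (auto simp: is_best_def eligible_def)

lemma best_eqI:
  assumes "is_best f M (eligible M R) u" "inj_on rank R"
  shows "best f M R = u"
proof -
  have "is_best f M (eligible M R) (best f M R)"
    unfolding best_def using assms(1) by (rule someI)
  then have "best f M R \<in> R" "u \<in> R" "rank (best f M R) = rank u"
    using assms(1) unfolding is_best_def eligible_def by force+
  then show ?thesis using assms(2) by (simp add: inj_on_eq_iff)
qed

function trace :: "('a set \<Rightarrow> real) \<Rightarrow> 'a set \<Rightarrow> 'a set \<Rightarrow> 'a set \<Rightarrow> 'a step list" where
  "trace f S M R =
    (if finite R \<and> eligible M R \<noteq> {}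
     then let u = best f M R in
       Step M R u (u \<in> S) # trace f S (if u \<in> S then insert u M else M) (R - {u})
     else [])"
  by auto
termination
  by (relation "Wellfounded.measure (\<lambda>(f, S, M, R). card R)")
    (auto simp del: card_Diff_insert intro!: card_Diff1_less best_in(2))

declare trace.simps [simp del]

lemma trace_Nil: "eligible M R = {} \<Longrightarrow> trace f S M R = []"
  by (subst trace.simps) simp

lemma trace_Cons:
  assumes "finite R" "eligible M R \<noteq> {}"
  shows "trace f S M R = Step M R (best f M R) (best f M R \<in> S) #
    trace f S (if best f M R \<in> S then insert (best f M R) M else M) (R - {best f M R})"
  by (subst trace.simps) (simp add: assms Let_def)

text \<open>Both outcomes of the coin are hypotheses, so that one induction serves runs with a fixed
  sample as well as expectations over all samples.\<close>

lemma process_induct [consumes 1, case_names Stop Step]: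
  assumes "finite R"
    and "\<And>M R. finite R \<Longrightarrow> eligible M R = {} \<Longrightarrow> P M R"
    and "\<And>M R. finite R \<Longrightarrow> eligible M R \<noteq> {} \<Longrightarrow> P (insert (best f M R) M) (R - {best f M R}) \<Longrightarrow>
      P M (R - {best f M R}) \<Longrightarrow> P M R"
  shows "P M R"
  using assms(1)
proof (induction "card R" arbitrary: M R rule: less_induct)
  case less
  show ?case
  proof (cases "eligible M R = {}")
    case True
    then show ?thesis using assms(2) less by blast
  next
    case False
    have "card (R - {best f M R}) < card R"
      using best_in(2)[OF less.prems False, of f] less.prems by (intro psubset_card_mono) auto
    then show ?thesis using assms(3) less False by auto
  qed
qed

section \<open>What the run depends on: coins, oracle values and available elements\<close>

lemma trace_coins_cong:
  assumes "finite R" "S \<inter> R = S' \<inter> R"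
  shows "trace f S M R = trace f S' M R"
  using assms
proof (induction M R rule: process_induct[where f = f])
  case (Step M R)
  let ?u = "best f M R"
  have "?u \<in> S \<longleftrightarrow> ?u \<in> S'" using Step best_in(2)[OF Step(1,2), of f] by auto
  moreover have "S \<inter> (R - {?u}) = S' \<inter> (R - {?u})" using Step.prems by auto
  ultimately show ?case using Step by (simp add: trace_Cons)
qed (simp add: trace_Nil)

text \<open>The choices compare values of subsets of \<open>M \<union> R\<close> only, so an oracle
  restricted to arrived elements can drive the simulation.\<close>

lemma trace_oracle_cong:
  assumes "finite R" "M \<union> R \<subseteq> X" "\<And>T. T \<subseteq> X \<Longrightarrow> f T = g T"
  shows "trace f S M R = trace g S M R"
  using assms(1,2)
proof (induction M R rule: process_induct[where f = f])
  case (Step M R)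
  let ?u = "best f M R"
  have eq: "f (insert v M) = g (insert v M)" if "v \<in> eligible M R" for v
  proof -
    have "insert v M \<subseteq> X" using that Step.prems by (auto simp: eligible_def)
    then show ?thesis by (rule assms(3))
  qed
  have "is_best f M (eligible M R) v \<longleftrightarrow> is_best g M (eligible M R) v" for v
    by (simp add: is_best_def eq cong: conj_cong ball_cong)
  then have u: "best g M R = ?u" by (simp add: best_def)
  have "?u \<in> R" using best_in(2)[OF Step(1,2)] .
  then have "insert ?u M \<union> (R - {?u}) \<subseteq> X" "M \<union> (R - {?u}) \<subseteq> X" using Step.prems by auto
  then show ?case using Step by (simp add: trace_Cons u)
qed (simp add: trace_Nil)

lemma trace_elem_remaining:
  assumes "finite R"
  shows "elem ` set (trace f S M R) \<subseteq> R"
  using assms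
proof (induction M R rule: process_induct[where f = f])
  case (Step M R)
  then show ?case using best_in(2)[OF Step(1,2), of f] by (auto simp: trace_Cons)
qed (simp add: trace_Nil)

lemma trace_heads:
  assumes "finite R" "e \<in> set (trace f S M R)"
  shows "heads e \<longleftrightarrow> elem e \<in> S"
  using assms
proof (induction M R rule: process_induct[where f = f])
  case (Step M R)
  then show ?case by (auto simp: trace_Cons split: if_splits)
qed (simp add: trace_Nil)

lemma distinct_trace:
  assumes "finite R"
  shows "distinct (map elem (trace f S M R))"
  using assms
proof (induction M R rule: process_induct[where f = f])
  case (Step M R)
  have "best f M R \<notin> elem ` set (trace f S M' (R - {best f M R}))" for M'
    using trace_elem_remaining[of "R - {best f M R}" f S M'] Step(1) by auto
  then show ?case using Step by (auto simp: trace_Cons)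
qed (simp add: trace_Nil)

text \<open>Elements outside the sample never change the state, so those that have not yet arrived
  can be left out. This makes the simulation online.\<close>
lemma trace_elem_restrict:
  assumes "finite R" "R' \<subseteq> R" "S \<inter> R \<subseteq> R'" "inj_on rank R"
  shows "elem ` set (trace f S M R') = elem ` set (trace f S M R) \<inter> R'"
  using assms
proof (induction M R arbitrary: R' rule: process_induct[where f = f])
  case (Stop M R)
  then have "eligible M R' = {}" by (auto simp: eligible_def)
  then show ?case using Stop by (simp add: trace_Nil)
next
  case (Step M R)
  let ?u = "best f M R"
  let ?M = "if ?u \<in> S then insert ?u M else M"
  have best: "is_best f M (eligible M R) ?u" by (rule best_is_best) (use Step in auto)
  have fin: "finite R'" using Step(1) Step.prems(1) by (rule rev_finite_subset)
  have inj: "inj_on rank (R - {?u})" using Step.prems by (auto intro: inj_on_subset)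
  have M': "elem ` set (trace f S M' (R' - {?u})) =
      elem ` set (trace f S M' (R - {?u})) \<inter> (R' - {?u})"
    if "M' = (if ?u \<in> S then insert ?u M else M)" for M'
  proof -
    have "R' - {?u} \<subseteq> R - {?u}" "S \<inter> (R - {?u}) \<subseteq> R' - {?u}" using Step.prems by auto
    from Step.IH(1)[OF this inj] Step.IH(2)[OF this inj] show ?thesis using that by simp
  qed
  show ?case
  proof (cases "?u \<in> R'")
    case True
    \<comment> \<open>Removing other candidates keeps \<open>?u\<close> optimal, and injectivity of
      \<open>rank\<close> makes it the choice in \<open>R'\<close> too.\<close>
    have "is_best f M (eligible M R') ?u"
      using best True Step.prems by (auto simp: is_best_def eligible_def)
    then have u: "best f M R' = ?u" using Step.prems by (intro best_eqI) (auto intro: inj_on_subset)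
    have "eligible M R' \<noteq> {}" using best True by (auto simp: is_best_def eligible_def)
    then have "elem ` set (trace f S M R') = insert ?u (elem ` set (trace f S ?M (R' - {?u})))"
      using fin by (simp add: trace_Cons u)
    moreover have "elem ` set (trace f S M R) = insert ?u (elem ` set (trace f S ?M (R - {?u})))"
      using Step(1,2) by (simp add: trace_Cons)
    moreover have "insert ?u (X \<inter> (R' - {?u})) = insert ?u X \<inter> R'" for X using True by blast
    ultimately show ?thesis by (simp only: M'[OF refl])
  next
    case False
    \<comment> \<open>All sampled elements of \<open>R\<close> lie in \<open>R'\<close>, so
      \<open>?u\<close> is tails: the state \<open>M\<close> does not change, and
      \<open>R' - {?u}\<close> is \<open>R'\<close>.\<close>
    then have "?u \<notin> S" using Step.prems best_in(2)[OF Step(1,2), of f] by auto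
    then show ?thesis using M'[OF refl] False Step(1,2) by (simp add: trace_Cons)
  qed
qed

section \<open>Expectation over the coins, one coin at a time\<close>

definition expect :: "real \<Rightarrow> ('a set \<Rightarrow> real) \<Rightarrow> 'a set \<Rightarrow> 'a set \<Rightarrow> ('a step list \<Rightarrow> real) \<Rightarrow> real" where
  "expect p f M R G = bernoulli_sum p R (\<lambda>S. G (trace f S M R))"

lemma expect_Stop:
  assumes "finite R" "eligible M R = {}"
  shows "expect p f M R G = G []"
  using assms by (simp add: expect_def trace_Nil bernoulli_sum_const)

text \<open>Once \<open>u\<close> has left \<open>R\<close>, its coin has no influence on the rest
  of the run, and the remaining coins are independent of it.\<close>

lemma expect_Step:
  fixes f :: "'a set \<Rightarrow> real"
  assumes "finite R" "eligible M R \<noteq> {}"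
  defines "u \<equiv> best f M R"
  shows "expect p f M R G =
    p * expect p f (insert u M) (R - {u}) (\<lambda>t. G (Step M R u True # t)) +
    (1 - p) * expect p f M (R - {u}) (\<lambda>t. G (Step M R u False # t))"
proof -
  have u: "u \<in> R" unfolding u_def by (rule best_in(2)) fact+
  have "bernoulli_sum p (R - {u}) (\<lambda>S. G (trace f (insert u S) M R)) =
      expect p f (insert u M) (R - {u}) (\<lambda>t. G (Step M R u True # t))"
    unfolding expect_def
  proof (rule bernoulli_sum_cong)
    fix S
    have "trace f (insert u S) (insert u M) (R - {u}) = trace f S (insert u M) (R - {u})"
      by (rule trace_coins_cong) (use assms in auto)
    then show "G (trace f (insert u S) M R) =
        G (Step M R u True # trace f S (insert u M) (R - {u}))"
      using assms by (simp add: trace_Cons)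
  qed
  moreover have "bernoulli_sum p (R - {u}) (\<lambda>S. G (trace f S M R)) =
      expect p f M (R - {u}) (\<lambda>t. G (Step M R u False # t))"
    unfolding expect_def
  proof (rule bernoulli_sum_cong)
    fix S assume "S \<subseteq> R - {u}"
    then show "G (trace f S M R) = G (Step M R u False # trace f S M (R - {u}))"
      using assms by (auto simp: trace_Cons)
  qed
  ultimately show ?thesis
    unfolding expect_def[of p f M R] by (simp add: bernoulli_sum_remove[OF assms(1) u])
qed

lemma expect_const: "finite R \<Longrightarrow> expect p f M R (\<lambda>_. c) = c"
  by (simp add: expect_def bernoulli_sum_const)

lemma expect_add: "expect p f M R (\<lambda>t. G t + H t) = expect p f M R G + expect p f M R H"
  by (simp add: expect_def bernoulli_sum_add)

lemma expect_cmult: "expect p f M R (\<lambda>t. c * G t) = c * expect p f M R G"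
  by (simp add: expect_def bernoulli_sum_cmult)

lemma expect_mono:
  assumes "0 \<le> p" "p \<le> 1" "\<And>S. S \<subseteq> R \<Longrightarrow> G (trace f S M R) \<le> H (trace f S M R)"
  shows "expect p f M R G \<le> expect p f M R H"
  using assms unfolding expect_def by (intro bernoulli_sum_mono)

end

subsection \<open>Expected gains of heads and tails\<close>

locale submodular_simulation = simulated_greedy I rank
  for I :: "'a set \<Rightarrow> bool" and rank :: "'a \<Rightarrow> nat" +
  fixes U :: "'a set" and f :: "'a set \<Rightarrow> real" and p :: real and k :: nat
  assumes finite_U: "finite U"
    and submod: "mono_submod U f"
    and I_subset: "I T \<Longrightarrow> T \<subseteq> U"
    and I_down: "I T \<Longrightarrow> T' \<subseteq> T \<Longrightarrow> I T'"
    and exchange: "I (M \<union> T) \<Longrightarrow> I (insert u M) \<Longrightarrow> \<exists>X\<subseteq>T. card X \<le> k \<and> I (insert u M \<union> (T - X))"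
    and p: "0 < p" "p \<le> 1" "1 \<le> p * (real k + 1)"
begin

definition gain :: "'a step \<Rightarrow> real" where
  "gain e = f (insert (elem e) (base e)) - f (base e)"

text \<open>In a run started on \<open>U\<close>, the set \<open>U - remaining e\<close> is
  everything processed before \<open>e\<close>, heads and tails alike. Marginals over so large a set
  can be added up for any selection of elements.\<close>

definition fresh_gain :: "'a step \<Rightarrow> real" where
  "fresh_gain e = f (insert (elem e) (U - remaining e)) - f (U - remaining e)"

definition head_gain :: "'a set \<Rightarrow> 'a step list \<Rightarrow> real" where
  "head_gain B t = (\<Sum>e\<leftarrow>filter (\<lambda>e. heads e \<and> elem e \<in> B) t. gain e)"

definition tail_fresh_gain :: "'a step list \<Rightarrow> real" where
  "tail_fresh_gain t = (\<Sum>e\<leftarrow>filter (\<lambda>e. \<not> heads e) t. fresh_gain e)"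

definition tail_count :: "'a set \<Rightarrow> 'a step list \<Rightarrow> nat" where
  "tail_count B t = length (filter (\<lambda>e. \<not> heads e \<and> elem e \<in> B) t)"

text \<open>The first element of \<open>B\<close> is taken whether it is heads or tails; along a run
  its gain bounds every later gain in \<open>B\<close>.\<close>

fun first_gain :: "'a set \<Rightarrow> 'a step list \<Rightarrow> real" where
  "first_gain B [] = 0"
| "first_gain B (e # t) = (if elem e \<in> B then gain e else first_gain B t)"

lemma gain_Step [simp]: "gain (Step M R u b) = f (insert u M) - f M"
  by (simp add: gain_def)

lemma fresh_gain_Step [simp]: "fresh_gain (Step M R u b) = f (insert u (U - R)) - f (U - R)"
  by (simp add: fresh_gain_def)

lemma head_gain_simps [simp]:
  "head_gain B [] = 0"
  "head_gain B (e # t) = (if heads e \<and> elem e \<in> B then gain e + head_gain B t else head_gain B t)"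
  by (simp_all add: head_gain_def)

lemma tail_fresh_gain_simps [simp]:
  "tail_fresh_gain [] = 0"
  "tail_fresh_gain (e # t) = (if heads e then tail_fresh_gain t else fresh_gain e + tail_fresh_gain t)"
  by (simp_all add: tail_fresh_gain_def)

lemma tail_count_simps [simp]:
  "tail_count B [] = 0"
  "tail_count B (e # t) = (if \<not> heads e \<and> elem e \<in> B then Suc (tail_count B t) else tail_count B t)"
  by (simp_all add: tail_count_def)

section \<open>Greedy heads against the optimum, and tails against heads\<close>

lemma marginal_nonneg:
  assumes "u \<in> U" "M \<subseteq> U"
  shows "0 \<le> f (insert u M) - f M"
  using mono_submodD(2)[OF submod, of M "insert u M"] assms by auto

lemma gain_le_best:
  assumes "finite R" "u \<in> R" "I (insert u M)"
  shows "f (insert u M) - f M \<le> f (insert (best f M R) M) - f M"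
proof -
  have u: "u \<in> eligible M R" using assms by (simp add: eligible_def)
  then have "is_best f M (eligible M R) (best f M R)" using assms(1) by (intro best_is_best) auto
  then show ?thesis using u by (auto simp: is_best_def)
qed

lemma best_props:
  assumes "finite R" "eligible M R \<noteq> {}" "R \<subseteq> U"
  shows "best f M R \<in> R" "I (insert (best f M R) M)" "best f M R \<in> U" "M \<subseteq> U"
  using best_in[OF assms(1,2), of f] assms(3) I_subset[of "insert (best f M R) M"]
  by (auto simp: eligible_def)

text \<open>\<open>T\<close> is what is left of an optimal set. A processed element of
  \<open>T\<close> leaves \<open>T\<close> at a loss of at most its gain; any other element, if
  heads, forces out at most \<open>k\<close> elements of \<open>T\<close>, none worth more than that
  gain by the greedy choice. Heads earn the gain with probability \<open>p\<close>, so the factor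
  \<open>k + 1\<close> pays for both, in the first case because
  \<open>1 \<le> p * (real k + 1)\<close>.\<close>

lemma opt_le_head_gain:
  assumes "finite R" "R \<subseteq> U" "M \<inter> R = {}" "T \<subseteq> R" "I (M \<union> T)"
  shows "f (M \<union> T) - f M \<le> (real k + 1) * expect p f M R (head_gain UNIV)"
  using assms
proof (induction M R arbitrary: T rule: process_induct[where f = f])
  case (Stop M R)
  have "T = {}"
  proof (rule ccontr)
    assume "T \<noteq> {}"
    then obtain t where "t \<in> T" by blast
    then have "t \<in> eligible M R" using Stop.prems by (auto simp: eligible_def intro: I_down)
    then show False using Stop by simp
  qed
  then show ?case using Stop by (simp add: expect_Stop)
next
  case (Step M R)
  let ?u = "best f M R"
  let ?d = "f (insert ?u M) - f M"
  let ?h = "expect p f (insert ?u M) (R - {?u}) (head_gain UNIV)"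
  let ?t = "expect p f M (R - {?u}) (head_gain UNIV)"
  note u = best_props[OF Step(1,2) Step.prems(1)]
  have MT: "M \<union> T \<subseteq> U" using I_subset Step.prems by blast
  have d: "0 \<le> ?d" using u by (intro marginal_nonneg)
  have ex: "expect p f M R (head_gain UNIV) = p * (?d + ?h) + (1 - p) * ?t"
    using Step(1)
    by (simp add: expect_Step[OF Step(1,2)] expect_add expect_const)
  have R': "R - {?u} \<subseteq> U" "insert ?u M \<inter> (R - {?u}) = {}" "M \<inter> (R - {?u}) = {}"
    using Step.prems by auto
  have "f (M \<union> T) - f M \<le> (real k + 1) * (p * ?h + (1 - p) * ?t) + p * (real k + 1) * ?d"
  proof (cases "?u \<in> T")
    case True
    have eq: "insert ?u M \<union> (T - {?u}) = M \<union> T" using True by auto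
    have T': "T - {?u} \<subseteq> R - {?u}" using Step.prems by auto
    have "I (M \<union> (T - {?u}))" by (rule I_down[OF Step.prems(4)]) auto
    from Step.IH(2)[OF R'(1,3) T' this]
    have "f (M \<union> (T - {?u})) - f M \<le> (real k + 1) * ?t" .
    moreover have "f (insert ?u (M \<union> (T - {?u}))) - f (M \<union> (T - {?u})) \<le> ?d"
      using MT u by (intro mono_submod_marginal_antimono[OF submod]) auto
    moreover have "insert ?u (M \<union> (T - {?u})) = M \<union> T" using True by auto
    ultimately have t: "f (M \<union> T) - f M \<le> (real k + 1) * ?t + ?d" by simp
    have h: "f (M \<union> T) - f M \<le> (real k + 1) * ?h + ?d"
      using Step.IH(1)[OF R'(1,2) T'] eq Step.prems(4) by simp
    have "f (M \<union> T) - f M = p * (f (M \<union> T) - f M) + (1 - p) * (f (M \<union> T) - f M)"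
      by (simp add: algebra_simps)
    also have "\<dots> \<le> p * ((real k + 1) * ?h + ?d) + (1 - p) * ((real k + 1) * ?t + ?d)"
      using p by (intro add_mono mult_left_mono t h) auto
    also have "\<dots> = (real k + 1) * (p * ?h + (1 - p) * ?t) + 1 * ?d"
      by (simp add: algebra_simps)
    also have "\<dots> \<le> (real k + 1) * (p * ?h + (1 - p) * ?t) + p * (real k + 1) * ?d"
      using p(3) d by (intro add_left_mono mult_right_mono) auto
    finally show ?thesis .
  next
    case False
    have T': "T \<subseteq> R - {?u}" using False Step.prems by auto
    have t: "f (M \<union> T) - f M \<le> (real k + 1) * ?t"
      using Step.IH(2)[OF R'(1,3) T' Step.prems(4)] .
    obtain X where X: "X \<subseteq> T" "card X \<le> k" "I (insert ?u M \<union> (T - X))"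
      using exchange[OF Step.prems(4) u(2)] by blast
    have finX: "finite X" by (rule finite_subset[OF _ Step(1)]) (use X(1) Step.prems(3) in auto)
    have XU: "X \<subseteq> U" using X(1) MT by auto
    have AU: "insert ?u M \<union> (T - X) \<subseteq> U" using I_subset X(3) by blast
    have "f (M \<union> T) \<le> f ((insert ?u M \<union> (T - X)) \<union> X)"
      by (rule mono_submodD(2)[OF submod]) (use AU XU in auto)
    also have "\<dots> \<le> f (insert ?u M \<union> (T - X)) + (\<Sum>t\<in>X. f (insert t M) - f M)"
      using finX XU AU by (intro mono_submod_union_le[OF submod]) auto
    also have "(\<Sum>t\<in>X. f (insert t M) - f M) \<le> (\<Sum>t\<in>X. ?d)"
    proof (rule sum_mono)
      fix t assume "t \<in> X"
      then have "t \<in> R" "insert t M \<subseteq> M \<union> T" using X(1) Step.prems(3) by auto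
      then show "f (insert t M) - f M \<le> ?d"
        using Step(1) I_down[OF Step.prems(4)] by (intro gain_le_best)
    qed
    also have "(\<Sum>t\<in>X. ?d) \<le> real k * ?d"
      using X(2) d by (simp add: mult_right_mono)
    also have "f (insert ?u M \<union> (T - X)) \<le> f (insert ?u M) + (real k + 1) * ?h"
    proof -
      have "T - X \<subseteq> R - {?u}" using T' by auto
      from Step.IH(1)[OF R'(1,2) this X(3)] show ?thesis by linarith
    qed
    \<comment> \<open>There are \<open>k\<close> gains for the elements dropped and one for the rise
      of \<open>f M\<close> itself.\<close>
    finally have h: "f (M \<union> T) - f M \<le> (real k + 1) * ?h + (real k + 1) * ?d"
      by (simp add: algebra_simps)
    have "f (M \<union> T) - f M = p * (f (M \<union> T) - f M) + (1 - p) * (f (M \<union> T) - f M)"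
      by (simp add: algebra_simps)
    also have "\<dots> \<le> p * ((real k + 1) * ?h + (real k + 1) * ?d) + (1 - p) * ((real k + 1) * ?t)"
      using p by (intro add_mono mult_left_mono t h) auto
    finally show ?thesis by (simp add: algebra_simps)
  qed
  then show ?case unfolding ex by (simp add: algebra_simps)
qed

text \<open>The fresh gains of all processed elements telescope to the rise of \<open>f\<close> on
  the processed set, which in the end contains the final \<open>M\<close>. Each is collected with
  probability \<open>1 - p\<close>, by a coin tossed after the element is fixed.\<close>

lemma tail_fresh_gain_ge:
  assumes "finite R" "R \<subseteq> U" "M \<subseteq> U" "M \<inter> R = {}"
  shows "(1 - p) * (expect p f M R (head_gain UNIV) + f M - f (U - R)) \<le>
    expect p f M R tail_fresh_gain"
  using assms
proof (induction M R rule: process_induct[where f = f])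
  case (Stop M R)
  have "f M \<le> f (U - R)" using Stop by (intro mono_submodD(2)[OF submod]) auto
  then show ?case using Stop p
    by (simp add: expect_Stop mult_nonneg_nonpos)
next
  case (Step M R)
  let ?u = "best f M R"
  let ?D = "U - R"
  let ?h = "expect p f (insert ?u M) (R - {?u})"
  let ?t = "expect p f M (R - {?u})"
  note u = best_props[OF Step(1,2) Step.prems(1)]
  have D: "U - (R - {?u}) = insert ?u ?D" using u by auto
  have ex: "expect p f M R (head_gain UNIV) =
      p * (f (insert ?u M) - f M + ?h (head_gain UNIV)) + (1 - p) * ?t (head_gain UNIV)"
    using Step(1)
    by (simp add: expect_Step[OF Step(1,2)] expect_add expect_const)
  have ex': "expect p f M R tail_fresh_gain =
      p * ?h tail_fresh_gain + (1 - p) * (f (insert ?u ?D) - f ?D + ?t tail_fresh_gain)"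
    using Step(1)
    by (simp add: expect_Step[OF Step(1,2)] expect_add expect_const)
  have h: "(1 - p) * (?h (head_gain UNIV) + f (insert ?u M) - f (insert ?u ?D)) \<le> ?h tail_fresh_gain"
    using Step.IH(1) Step.prems u unfolding D by auto
  have t: "(1 - p) * (?t (head_gain UNIV) + f M - f (insert ?u ?D)) \<le> ?t tail_fresh_gain"
    using Step.IH(2) Step.prems u unfolding D by auto
  \<comment> \<open>This is an identity: the terms in \<open>f (insert ?u ?D)\<close>
    cancel.\<close>
  have "(1 - p) * (expect p f M R (head_gain UNIV) + f M - f ?D) =
     p * ((1 - p) * (?h (head_gain UNIV) + f (insert ?u M) - f (insert ?u ?D))) +
     (1 - p) * (f (insert ?u ?D) - f ?D + (1 - p) * (?t (head_gain UNIV) + f M - f (insert ?u ?D)))"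
    unfolding ex by (simp add: algebra_simps)
  also have "\<dots> \<le> expect p f M R tail_fresh_gain"
    unfolding ex' using p by (intro add_mono mult_left_mono h t order_refl) auto
  finally show ?case .
qed

section \<open>Tails in excess of a capacity\<close>

text \<open>While \<open>M\<close> has fewer than \<open>m\<close> elements of \<open>B\<close>, \<open>x\<close> to the number of tails in \<open>B\<close> times
  \<open>y\<close> to minus the number of heads in \<open>B\<close> is a supermartingale.\<close>
lemma expect_tail_excess_le:
  assumes "finite R" "R \<subseteq> U" "M \<inter> R = {}" "I M"
    and cap: "\<And>T. I T \<Longrightarrow> card (T \<inter> B) \<le> m"
    and x: "2 \<le> x" and y: "1 \<le> y" and xy: "p / y + (1 - p) * x \<le> 1"
  shows "expect p f M R (\<lambda>t. real (n + tail_count B t - m)) \<le>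
    x ^ n / x ^ Suc m * y ^ (m - card (M \<inter> B))"
  using assms(1-4)
proof (induction M R arbitrary: n rule: process_induct[where f = f])
  case (Stop M R)
  have "real (n - m) \<le> x ^ n / x ^ Suc m * y ^ (m - card (M \<inter> B))"
  proof (cases "n \<le> m")
    case True
    then show ?thesis using x y by simp
  next
    case False
    \<comment> \<open>The excess \<open>n - m\<close> is \<open>Suc j\<close>, and
      \<open>Suc j \<le> 2 ^ j \<le> x ^ j\<close>; this is why the bound may divide by
      \<open>x ^ Suc m\<close> and not just by \<open>x ^ m\<close>.\<close>
    then obtain j where j: "n = Suc m + j" using not_less_eq_eq le_Suc_ex by blast
    have "real (Suc j) \<le> 2 ^ j"
      using less_exp[of j] by (metis Suc_leI of_nat_le_iff of_nat_numeral of_nat_power)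
    also have "\<dots> \<le> x ^ j * 1" using x by (simp add: power_mono)
    also have "\<dots> \<le> x ^ j * y ^ (m - card (M \<inter> B))"
      using x y by (intro mult_left_mono one_le_power) auto
    also have "x ^ j = x ^ n / x ^ Suc m" using x by (simp add: j power_add)
    finally show ?thesis using j by simp
  qed
  then show ?case using Stop by (simp add: expect_Stop)
next
  case (Step M R)
  let ?u = "best f M R"
  note u = best_props[OF Step(1,2) Step.prems(1)]
  have R': "R - {?u} \<subseteq> U" "insert ?u M \<inter> (R - {?u}) = {}" "M \<inter> (R - {?u}) = {}"
    using Step.prems by auto
  note h = Step.IH(1)[OF R'(1,2) u(2)] and t = Step.IH(2)[OF R'(1,3) Step.prems(3)]
  show ?case
  proof (cases "?u \<in> B")
    case False
    have "expect p f M R (\<lambda>t. real (n + tail_count B t - m)) =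
        p * expect p f (insert ?u M) (R - {?u}) (\<lambda>t. real (n + tail_count B t - m)) +
        (1 - p) * expect p f M (R - {?u}) (\<lambda>t. real (n + tail_count B t - m))"
      using False by (simp add: expect_Step[OF Step(1,2)])
    also have "\<dots> \<le> p * (x ^ n / x ^ Suc m * y ^ (m - card (insert ?u M \<inter> B))) +
        (1 - p) * (x ^ n / x ^ Suc m * y ^ (m - card (M \<inter> B)))"
      using p by (intro add_mono mult_left_mono h t) auto
    also have "insert ?u M \<inter> B = M \<inter> B" using False by auto
    finally show ?thesis by (simp only: distrib_right[symmetric]) simp
  next
    case True
    have "?u \<notin> M" using u(1) Step.prems(2) by auto
    moreover have "finite M" using u(4) finite_U by (rule finite_subset)
    ultimately have c: "card (insert ?u M \<inter> B) = Suc (card (M \<inter> B))" using True by simp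
    \<comment> \<open>As \<open>insert ?u M\<close> is independent, its count does not exceed
      \<open>m\<close>, so the truncated difference drops by exactly one.\<close>
    then have m: "m - card (M \<inter> B) = Suc (m - card (insert ?u M \<inter> B))"
      using cap[OF u(2)] by simp
    let ?z = "x ^ n / x ^ Suc m * y ^ (m - card (M \<inter> B))"
    have "expect p f M R (\<lambda>t. real (n + tail_count B t - m)) =
        p * expect p f (insert ?u M) (R - {?u}) (\<lambda>t. real (n + tail_count B t - m)) +
        (1 - p) * expect p f M (R - {?u}) (\<lambda>t. real (Suc n + tail_count B t - m))"
      using True by (simp add: expect_Step[OF Step(1,2)])
    also have "\<dots> \<le> p * (x ^ n / x ^ Suc m * y ^ (m - card (insert ?u M \<inter> B))) +
        (1 - p) * (x ^ Suc n / x ^ Suc m * y ^ (m - card (M \<inter> B)))"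
      using h[of n] t[of "Suc n"] p by (intro add_mono mult_left_mono) auto
    \<comment> \<open>Heads divide the bound by \<open>y\<close> and tails multiply it by
      \<open>x\<close>; by \<open>xy\<close> the average factor is at most 1.\<close>
    also have "\<dots> = (p / y + (1 - p) * x) * ?z"
      unfolding m using y x by (simp add: field_simps)
    also have "\<dots> \<le> 1 * ?z" using x y by (intro mult_right_mono xy) auto
    finally show ?thesis by simp
  qed
qed

text \<open>For \<open>M = {}\<close> the second inclusion places \<open>base e\<close> among the
  elements processed before \<open>e\<close>, which is what compares fresh gains with gains.\<close>

lemma trace_step_props:
  assumes "finite R" "R \<subseteq> U" "e \<in> set (trace f S M R)"
  shows "M \<subseteq> base e \<and> base e \<subseteq> U - remaining e \<union> M \<and> remaining e \<subseteq> R \<and>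
    elem e \<in> R \<and> I (insert (elem e) (base e))"
  using assms
proof (induction M R rule: process_induct[where f = f])
  case (Step M R)
  note u = best_props[OF Step(1,2) Step.prems(1)]
  show ?case
  proof (cases "e = Step M R (best f M R) (best f M R \<in> S)")
    case True
    then show ?thesis using u by auto
  next
    case False
    then have "e \<in> set (trace f S (if best f M R \<in> S then insert (best f M R) M else M)
        (R - {best f M R}))"
      using Step.prems(2) Step(1,2) by (simp add: trace_Cons)
    then show ?thesis using Step.IH Step.prems(1) u by (auto split: if_splits)
  qed
qed (simp add: trace_Nil)

lemma gain_nonneg:
  assumes "finite R" "R \<subseteq> U" "e \<in> set (trace f S M R)"
  shows "0 \<le> gain e"
  using trace_step_props[OF assms] I_subset[of "insert (elem e) (base e)"]
  unfolding gain_def by (intro marginal_nonneg) auto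

lemma head_gain_nonneg:
  assumes "finite R" "R \<subseteq> U"
  shows "0 \<le> head_gain B (trace f S M R)"
  unfolding head_gain_def using gain_nonneg[OF assms] by (intro sum_list_nonneg) auto

text \<open>After swapping the sums, the gain of each head is weighted by the total \<open>c\<close>
  of the sets containing it, at most \<open>C\<close>.\<close>

lemma weighted_head_gain_le:
  assumes "finite L" and C: "\<And>u. (\<Sum>B | B \<in> L \<and> u \<in> B. c B) \<le> C"
    and "\<forall>e\<in>set t. 0 \<le> gain e"
  shows "(\<Sum>B\<in>L. c B * head_gain B t) \<le> C * head_gain UNIV t"
  using assms(3)
proof (induction t)
  case (Cons e t)
  show ?case
  proof (cases "heads e")
    case True
    have "(\<Sum>B\<in>L. c B * head_gain B (e # t)) =
        (\<Sum>B\<in>L. (if elem e \<in> B then c B * gain e else 0) + c B * head_gain B t)"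
      using True by (intro sum.cong) (auto simp: distrib_left)
    also have "\<dots> = (\<Sum>B\<in>L. if elem e \<in> B then c B * gain e else 0) + (\<Sum>B\<in>L. c B * head_gain B t)"
      by (rule sum.distrib)
    also have "(\<Sum>B\<in>L. if elem e \<in> B then c B * gain e else 0) =
        (\<Sum>B | B \<in> L \<and> elem e \<in> B. c B) * gain e"
      using assms(1) by (simp only: sum.inter_filter[symmetric] sum_distrib_right)
    also have "\<dots> \<le> C * gain e" using Cons.prems by (intro mult_right_mono C) auto
    also have "(\<Sum>B\<in>L. c B * head_gain B t) \<le> C * head_gain UNIV t" using Cons by simp
    finally show ?thesis using True by (simp add: distrib_left)
  next
    case False
    then show ?thesis using Cons by simp
  qed
qed simp

lemma expect_head_gain_nonneg:
  assumes "finite R" "R \<subseteq> U"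
  shows "0 \<le> expect p f M R (head_gain B)"
proof -
  have "expect p f M R (\<lambda>_. 0) \<le> expect p f M R (head_gain B)"
    using p head_gain_nonneg[OF assms] by (intro expect_mono) auto
  then show ?thesis using assms by (simp add: expect_const)
qed

text \<open>When the first element of \<open>B\<close> is processed, \<open>e\<close> is already a
  candidate, since independence passes to subsets. So the greedy choice is worth at least as much as
  \<open>e\<close> at that moment, and the marginal of \<open>e\<close> only falls as the state
  grows.\<close>

lemma gain_le_first_gain:
  assumes "finite R" "R \<subseteq> U" "e \<in> set (trace f S M R)" "elem e \<in> B"
  shows "gain e \<le> first_gain B (trace f S M R)"
  using assms
proof (induction M R rule: process_induct[where f = f])
  case (Step M R)
  let ?u = "best f M R"
  note u = best_props[OF Step(1,2) Step.prems(1)]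
  show ?case
  proof (cases "?u \<in> B")
    case True
    note e = trace_step_props[OF Step(1) Step.prems(1,2)]
    have "insert (elem e) (base e) \<subseteq> U" using e I_subset by blast
    then have "gain e \<le> f (insert (elem e) M) - f M"
      unfolding gain_def using e by (intro mono_submod_marginal_antimono[OF submod]) auto
    also have "\<dots> \<le> f (insert ?u M) - f M"
    proof (rule gain_le_best)
      show "I (insert (elem e) M)" by (rule I_down[of "insert (elem e) (base e)"]) (use e in auto)
    qed (use Step e in auto)
    finally show ?thesis using True Step(1,2) by (simp add: trace_Cons)
  next
    case False
    then have "e \<in> set (trace f S (if ?u \<in> S then insert ?u M else M) (R - {?u}))"
      using Step.prems(2,3) Step(1,2) by (auto simp: trace_Cons)
    then show ?thesis using Step.IH Step.prems(1,3) False Step(1,2)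
      by (auto simp: trace_Cons split: if_splits)
  qed
qed (simp add: trace_Nil)

text \<open>Steps outside \<open>B\<close> merely average both sides. At the first element of
  \<open>B\<close>, of gain \<open>d\<close> say, the expected excess is bounded by the
  supermartingale, while the expected head gain in \<open>B\<close> is at least
  \<open>p * d\<close>.\<close>

lemma expect_excess_first_gain_le:
  assumes "finite R" "R \<subseteq> U" "M \<inter> R = {}" "I M" "M \<inter> B = {}"
    and cap: "\<And>T. I T \<Longrightarrow> card (T \<inter> B) \<le> m"
    and x: "2 \<le> x" and y: "1 \<le> y" and xy: "p / y + (1 - p) * x \<le> 1"
  shows "expect p f M R (\<lambda>t. real (tail_count B t - m) * first_gain B t) \<le>
    y ^ m / (x ^ Suc m * p) * expect p f M R (head_gain B)"
  using assms(1-5)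
proof (induction M R rule: process_induct[where f = f])
  case (Stop M R)
  then show ?case by (simp add: expect_Stop)
next
  case (Step M R)
  let ?u = "best f M R"
  let ?c = "y ^ m / (x ^ Suc m * p)"
  let ?h = "expect p f (insert ?u M) (R - {?u})"
  let ?t = "expect p f M (R - {?u})"
  note u = best_props[OF Step(1,2) Step.prems(1)]
  have R': "R - {?u} \<subseteq> U" "insert ?u M \<inter> (R - {?u}) = {}" "M \<inter> (R - {?u}) = {}"
    using Step.prems by auto
  have c: "0 \<le> ?c" using x y p by simp
  show ?case
  proof (cases "?u \<in> B")
    case False
    have "insert ?u M \<inter> B = {}" using False Step.prems by auto
    note h = Step.IH(1)[OF R'(1,2) u(2) this] and t = Step.IH(2)[OF R'(1,3) Step.prems(3,4)]
    have "expect p f M R (\<lambda>t. real (tail_count B t - m) * first_gain B t) =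
        p * ?h (\<lambda>t. real (tail_count B t - m) * first_gain B t) +
        (1 - p) * ?t (\<lambda>t. real (tail_count B t - m) * first_gain B t)"
      using False by (simp add: expect_Step[OF Step(1,2)])
    also have "\<dots> \<le> p * (?c * ?h (head_gain B)) + (1 - p) * (?c * ?t (head_gain B))"
      using h t p by (intro add_mono mult_left_mono) auto
    also have "\<dots> = ?c * (p * ?h (head_gain B) + (1 - p) * ?t (head_gain B))"
      by (simp only: distrib_left mult.left_commute)
    also have "p * ?h (head_gain B) + (1 - p) * ?t (head_gain B) = expect p f M R (head_gain B)"
      using False by (simp add: expect_Step[OF Step(1,2)])
    finally show ?thesis .
  next
    case True
    let ?d = "f (insert ?u M) - f M"
    have d: "0 \<le> ?d" using u by (intro marginal_nonneg)
    \<comment> \<open>For every sample \<open>first_gain\<close> now equals \<open>?d\<close>, so it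
      can be pulled out of the expectation.\<close>
    have "expect p f M R (\<lambda>t. real (tail_count B t - m) * first_gain B t) =
        ?d * expect p f M R (\<lambda>t. real (0 + tail_count B t - m))"
      unfolding expect_cmult[symmetric] unfolding expect_def
      using True Step(1,2) by (intro bernoulli_sum_cong) (simp add: trace_Cons)
    also have "\<dots> \<le> ?d * (x ^ 0 / x ^ Suc m * y ^ (m - card (M \<inter> B)))"
      using Step(1) Step.prems cap x y xy d
      by (intro mult_left_mono expect_tail_excess_le) auto
    also have "\<dots> = ?c * (p * ?d)" using Step.prems p by simp
    also have "\<dots> \<le> ?c * expect p f M R (head_gain B)"
    proof (rule mult_left_mono[OF _ c])
      have "expect p f M R (head_gain B) = p * (?d + ?h (head_gain B)) + (1 - p) * ?t (head_gain B)"
        using True Step(1)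
        by (simp add: expect_Step[OF Step(1,2)] expect_add expect_const)
      moreover have "0 \<le> ?h (head_gain B)" "0 \<le> ?t (head_gain B)"
        using Step(1) R' by (auto intro!: expect_head_gain_nonneg)
      moreover have "p * ?d \<le> p * (?d + a) + (1 - p) * b" if "0 \<le> a" "0 \<le> b" for a b
        using that p by (simp add: distrib_left)
      ultimately show "p * ?d \<le> expect p f M R (head_gain B)" by simp
    qed
    finally show ?thesis .
  qed
qed

section \<open>The value of an accepted set from below\<close>

lemma fresh_gain_le_gain:
  assumes "e \<in> set (trace f S {} U)"
  shows "fresh_gain e \<le> gain e"
  using trace_step_props[OF finite_U order_refl assms]
  unfolding gain_def fresh_gain_def by (intro mono_submod_marginal_antimono[OF submod]) auto

text \<open>If \<open>A\<close> is built up in the order of processing, each step adds a marginal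
  over a subset of the elements processed before, hence at least the fresh gain.\<close>

lemma value_ge_sum_fresh_gain:
  assumes "finite R" "R \<subseteq> U" "A \<subseteq> U"
  shows "(\<Sum>e\<leftarrow>filter (\<lambda>e. elem e \<in> A) (trace f S M R). fresh_gain e) \<le> f A - f (A - R)"
  using assms(1,2)
proof (induction M R rule: process_induct[where f = f])
  case (Stop M R)
  have "f (A - R) \<le> f A" using assms(3) by (intro mono_submodD(2)[OF submod]) auto
  then show ?case using Stop by (simp add: trace_Nil)
next
  case (Step M R)
  let ?u = "best f M R"
  let ?M = "if ?u \<in> S then insert ?u M else M"
  note u = best_props[OF Step(1,2) Step.prems(1)]
  have IH: "(\<Sum>e\<leftarrow>filter (\<lambda>e. elem e \<in> A) (trace f S ?M (R - {?u})). fresh_gain e) \<le>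
      f A - f (A - (R - {?u}))"
    using Step.IH Step.prems by auto
  show ?case
  proof (cases "?u \<in> A")
    case True
    have "A - (R - {?u}) = insert ?u (A - R)" using True by auto
    moreover have "f (insert ?u (U - R)) - f (U - R) \<le> f (insert ?u (A - R)) - f (A - R)"
      using assms(3) u by (intro mono_submod_marginal_antimono[OF submod]) auto
    ultimately show ?thesis using IH True Step(1,2) by (simp add: trace_Cons)
  next
    case False
    then have "A - (R - {?u}) = A - R" by auto
    then show ?thesis using IH False Step(1,2) by (simp add: trace_Cons)
  qed
qed

text \<open>The fresh gains of the tails in \<open>A\<close> are covered by
  \<open>f A - f {}\<close>. The other tails are charged their larger \<open>gain\<close>, which the
  capacity argument can bound.\<close>

lemma value_ge_tail_fresh_gain:
  fixes S defines "t \<equiv> trace f S {} U"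
  assumes A: "A \<subseteq> U - S"
  shows "f {} + tail_fresh_gain t - (\<Sum>e\<leftarrow>filter (\<lambda>e. \<not> heads e \<and> elem e \<notin> A) t. gain e) \<le> f A"
proof -
  have "tail_fresh_gain t =
      (\<Sum>e\<leftarrow>filter (\<lambda>e. \<not> heads e \<and> elem e \<in> A) t. fresh_gain e) +
      (\<Sum>e\<leftarrow>filter (\<lambda>e. \<not> heads e \<and> elem e \<notin> A) t. fresh_gain e)"
    unfolding tail_fresh_gain_def by (induction t) auto
  also have "filter (\<lambda>e. \<not> heads e \<and> elem e \<in> A) t = filter (\<lambda>e. elem e \<in> A) t"
    using A trace_heads[OF finite_U] unfolding t_def by (intro filter_cong) auto
  also have "(\<Sum>e\<leftarrow>filter (\<lambda>e. elem e \<in> A) t. fresh_gain e) \<le> f A - f (A - U)"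
    unfolding t_def using A by (intro value_ge_sum_fresh_gain finite_U) auto
  also have "A - U = {}" using A by auto
  also have "(\<Sum>e\<leftarrow>filter (\<lambda>e. \<not> heads e \<and> elem e \<notin> A) t. fresh_gain e) \<le>
      (\<Sum>e\<leftarrow>filter (\<lambda>e. \<not> heads e \<and> elem e \<notin> A) t. gain e)"
    unfolding t_def by (intro sum_list_mono fresh_gain_le_gain) auto
  finally show ?thesis by simp
qed

end

subsection \<open>Exchange in laminar matroids\<close>

lemma laminar_indep_subset:
  assumes "laminar_indep U F mu T" "T' \<subseteq> T" "finite U"
  shows "laminar_indep U F mu T'"
  unfolding laminar_indep_def
proof (intro conjI ballI)
  have T: "T \<subseteq> U" "finite T" using assms finite_subset by (auto simp: laminar_indep_def)
  show "T' \<subseteq> U" using assms(2) T by auto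
  fix B assume "B \<in> F"
  have "card (T' \<inter> B) \<le> card (T \<inter> B)" using T assms(2) by (intro card_mono) auto
  also have "\<dots> \<le> mu B" using assms(1) \<open>B \<in> F\<close> by (simp add: laminar_indep_def)
  finally show "card (T' \<inter> B) \<le> mu B" .
qed

text \<open>The sets that overflow once \<open>u\<close> is added all contain \<open>u\<close>, so
  they form a chain, and each overflows by one. An element of the smallest lies in all of them, and
  removing it repairs every one.\<close>

lemma laminar_exchange:
  assumes fin: "finite U" and lam: "laminar_family U F"
    and MT: "laminar_indep U F mu (M \<union> T)" and Mu: "laminar_indep U F mu (insert u M)"
  shows "\<exists>X\<subseteq>T. card X \<le> 1 \<and> laminar_indep U F mu (insert u M \<union> (T - X))"
proof -
  define tight where "tight = {B \<in> F. u \<in> B \<and> mu B < card (insert u (M \<union> T) \<inter> B)}"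
  have sub: "insert u (M \<union> T) \<subseteq> U" using MT Mu by (auto simp: laminar_indep_def)
  have finMT: "finite (insert u (M \<union> T))" using sub fin by (rule finite_subset)
  have le: "card (insert u (M \<union> T) \<inter> B) \<le> mu B" if B: "B \<in> F" "B \<notin> tight" for B
  proof (cases "u \<in> B")
    case True
    then show ?thesis using B by (auto simp: tight_def)
  next
    case False
    then have "insert u (M \<union> T) \<inter> B = (M \<union> T) \<inter> B" by auto
    then show ?thesis using MT B by (simp add: laminar_indep_def)
  qed
  show ?thesis
  proof (cases "tight = {}")
    case True
    then have "laminar_indep U F mu (insert u (M \<union> T))"
      using sub le by (auto simp: laminar_indep_def)
    then show ?thesis by (intro exI[of _ "{}"]) simp
  next
    case False
    then obtain B0 where B0: "B0 \<in> tight" "\<And>B. B \<in> tight \<Longrightarrow> card B0 \<le> card B"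
      using ex_has_least_nat[of "\<lambda>B. B \<in> tight" _ card] by blast
    \<comment> \<open>Some element of the overfull \<open>B0\<close> must come from
      \<open>T\<close>, because \<open>insert u M\<close> alone respects its capacity.\<close>
    have "\<not> insert u (M \<union> T) \<inter> B0 \<subseteq> insert u M \<inter> B0"
    proof
      assume "insert u (M \<union> T) \<inter> B0 \<subseteq> insert u M \<inter> B0"
      then have "card (insert u (M \<union> T) \<inter> B0) \<le> card (insert u M \<inter> B0)"
        using finMT by (intro card_mono) auto
      also have "\<dots> \<le> mu B0" using Mu B0 by (auto simp: laminar_indep_def tight_def)
      finally show False using B0 by (simp add: tight_def)
    qed
    then obtain t where t: "t \<in> T" "t \<in> B0" "t \<notin> M" "t \<noteq> u" by blast
    have "laminar_indep U F mu (insert u M \<union> (T - {t}))"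
      unfolding laminar_indep_def
    proof (intro conjI ballI)
      show "insert u M \<union> (T - {t}) \<subseteq> U" using sub by auto
      fix B assume B: "B \<in> F"
      show "card ((insert u M \<union> (T - {t})) \<inter> B) \<le> mu B"
      proof (cases "B \<in> tight")
        case False
        have "card ((insert u M \<union> (T - {t})) \<inter> B) \<le> card (insert u (M \<union> T) \<inter> B)"
          using finMT by (intro card_mono) auto
        then show ?thesis using le[OF B False] by simp
      next
        case True
        have F: "B0 \<in> F" "u \<in> B0" "B \<in> F" "u \<in> B" using B0 True by (auto simp: tight_def)
        have "finite B0" using lam F(1) fin unfolding laminar_family_def by (metis finite_subset)
        moreover have "B0 \<subseteq> B \<or> B \<subseteq> B0" using lam F unfolding laminar_family_def by blast
        ultimately have "B0 \<subseteq> B" using card_seteq[of B0 B] B0(2)[OF True] by auto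
        then have tB: "t \<in> insert u (M \<union> T) \<inter> B" using t by auto
        have "(insert u M \<union> (T - {t})) \<inter> B = insert u (M \<union> T) \<inter> B - {t}" using t by auto
        moreover have "insert u (M \<union> T) \<inter> B = insert u ((M \<union> T) \<inter> B)"
          using True by (auto simp: tight_def)
        moreover have "card (insert u ((M \<union> T) \<inter> B)) \<le> Suc (card ((M \<union> T) \<inter> B))"
          by (rule card_insert_le_m1) auto
        moreover have "card ((M \<union> T) \<inter> B) \<le> mu B" using MT B by (simp add: laminar_indep_def)
        ultimately show ?thesis using tB finMT by (simp add: card_Diff_singleton)
      qed
    qed
    then show ?thesis using t by (intro exI[of _ "{t}"]) auto
  qed
qed

text \<open>Each matroid asks for at most one removal, and the removals asked for by the others keep
  independence.\<close>

lemma laminar_intersection_exchange: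
  assumes fin: "finite U" and lam: "\<forall>i<k. laminar_family U (Fs i)"
    and MT: "\<forall>i<k. laminar_indep U (Fs i) (mu i) (M \<union> T)"
    and Mu: "\<forall>i<k. laminar_indep U (Fs i) (mu i) (insert u M)"
  shows "\<exists>X\<subseteq>T. card X \<le> k \<and> (\<forall>i<k. laminar_indep U (Fs i) (mu i) (insert u M \<union> (T - X)))"
proof -
  have "\<forall>i\<in>{..<k}. \<exists>X. X \<subseteq> T \<and> card X \<le> 1 \<and> laminar_indep U (Fs i) (mu i) (insert u M \<union> (T - X))"
    using laminar_exchange[OF fin] lam MT Mu by (metis lessThan_iff)
  then obtain X where X: "\<And>i. i < k \<Longrightarrow> X i \<subseteq> T" "\<And>i. i < k \<Longrightarrow> card (X i) \<le> 1"
      "\<And>i. i < k \<Longrightarrow> laminar_indep U (Fs i) (mu i) (insert u M \<union> (T - X i))"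
    by (metis lessThan_iff bchoice)
  have "card (\<Union>i<k. X i) \<le> (\<Sum>i<k. card (X i))" by (rule card_UN_le) simp
  also have "\<dots> \<le> (\<Sum>i<k. 1)" using X(2) by (intro sum_mono) auto
  finally have "card (\<Union>i<k. X i) \<le> k" by simp
  moreover have "laminar_indep U (Fs i) (mu i) (insert u M \<union> (T - (\<Union>i<k. X i)))" if "i < k" for i
    using X(3)[OF that] by (rule laminar_indep_subset) (use that fin in auto)
  ultimately show ?thesis using X(1) by (intro exI[of _ "\<Union>i<k. X i"]) auto
qed

subsection \<open>The online algorithm\<close>

context simulated_greedy
begin

text \<open>The run uses only the sample and \<open>u\<close>, all of which have arrived by the time
  \<open>u\<close> is judged. By \<open>trace_elem_restrict\<close> it processes \<open>u\<close>
  exactly if the run on the whole ground set does.\<close>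

definition qualifies :: "('a set \<Rightarrow> real) \<Rightarrow> 'a set \<Rightarrow> 'a \<Rightarrow> bool" where
  "qualifies f S u \<longleftrightarrow> u \<notin> S \<and> u \<in> elem ` set (trace f S {} (insert u S))"

definition select :: "('a \<Rightarrow> bool) \<Rightarrow> 'a list \<Rightarrow> 'a set" where
  "select Q xs = foldl (\<lambda>A u. if Q u \<and> I (insert u A) then insert u A else A) {} xs"

text \<open>\<open>m\<close> is the sample size and the last entry of \<open>l\<close> the current
  element. The set accepted so far is recomputed from the earlier arrivals.\<close>

definition decide :: "nat \<Rightarrow> 'a list \<Rightarrow> ('a set \<Rightarrow> real) \<Rightarrow> bool" where
  "decide m l g \<longleftrightarrow> m < length l \<and> (let Q = qualifies g (set (take m l)) in
     Q (last l) \<and> I (insert (last l) (select Q (drop m (butlast l)))))"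

lemma select_Nil [simp]: "select Q [] = {}"
  by (simp add: select_def)

lemma select_snoc [simp]:
  "select Q (xs @ [u]) =
    (if Q u \<and> I (insert u (select Q xs)) then insert u (select Q xs) else select Q xs)"
  by (simp add: select_def)

lemma select_cong:
  assumes "\<And>u. u \<in> set xs \<Longrightarrow> Q u = Q' u"
  shows "select Q xs = select Q' xs"
  using assms by (induction xs rule: rev_induct) auto

lemma select_subset: "select Q xs \<subseteq> {u \<in> set xs. Q u}"
  by (induction xs rule: rev_induct) auto

lemma select_indep: "I {} \<Longrightarrow> I (select Q xs)"
  by (induction xs rule: rev_induct) auto

text \<open>An element turned away stays infeasible while the selection grows.\<close>

lemma select_maximal:
  assumes down: "\<And>T T'. I T \<Longrightarrow> T' \<subseteq> T \<Longrightarrow> I T'"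
    and "u \<in> set xs" "Q u" "u \<notin> select Q xs"
  shows "\<not> I (insert u (select Q xs))"
  using assms(2-4)
proof (induction xs rule: rev_induct)
  case (snoc v xs)
  have "\<not> I (insert u (select Q xs))" using snoc by (auto split: if_splits)
  moreover have "insert u (select Q xs) \<subseteq> insert u (select Q (xs @ [v]))" by auto
  ultimately show ?case by (auto dest: down)
qed simp

lemma qualifies_restrict_oracle:
  assumes "finite S" "insert u S \<subseteq> X"
  shows "qualifies (restrict_oracle f X) S u = qualifies f S u"
proof -
  have "trace (restrict_oracle f X) S {} (insert u S) = trace f S {} (insert u S)"
    by (rule trace_oracle_cong[where X = X]) (use assms in \<open>auto simp: restrict_oracle_def\<close>)
  then show ?thesis by (simp add: qualifies_def)
qed

text \<open>The restricted oracle changes with every arrival but always agrees with \<open>f\<close>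
  on the sets queried, so all recomputations use the same test and yield the same partial
  selection.\<close>

lemma accepted_decide:
  "accepted (decide m) f \<sigma> = select (qualifies f (set (take m \<sigma>))) (drop m \<sigma>)"
proof -
  let ?Q = "qualifies f (set (take m \<sigma>))"
  let ?d = "\<lambda>i. decide m (take (Suc i) \<sigma>) (restrict_oracle f (set (take (Suc i) \<sigma>)))"
  have "{\<sigma> ! i | i. i < j \<and> ?d i} = select ?Q (drop m (take j \<sigma>))" if "j \<le> length \<sigma>" for j
    using that
  proof (induction j)
    case (Suc j)
    let ?X = "set (take (Suc j) \<sigma>)"
    have tk: "take (Suc j) \<sigma> = take j \<sigma> @ [\<sigma> ! j]"
      using Suc.prems by (simp add: take_Suc_conv_app_nth)
    have split: "{\<sigma> ! i | i. i < Suc j \<and> ?d i} =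
        {\<sigma> ! i | i. i < j \<and> ?d i} \<union> (if ?d j then {\<sigma> ! j} else {})"
      by (auto simp: less_Suc_eq)
    show ?case
    proof (cases "m \<le> j")
      case False
      then have "\<not> ?d j" by (simp add: decide_def)
      then show ?thesis using Suc split False by simp
    next
      case True
      have tm: "take m (take (Suc j) \<sigma>) = take m \<sigma>" using True by (simp add: min_def)
      have Q: "qualifies (restrict_oracle f ?X) (set (take m \<sigma>)) u = ?Q u" if "u \<in> ?X" for u
        by (rule qualifies_restrict_oracle)
          (use that True set_take_subset_set_take[of m "Suc j" \<sigma>] in auto)
      have dr: "drop m (take (Suc j) \<sigma>) = drop m (take j \<sigma>) @ [\<sigma> ! j]"
        using True Suc.prems by (simp add: tk)
      have "set (drop m (take j \<sigma>)) \<subseteq> ?X" using set_drop_subset[of m "take j \<sigma>"] by (auto simp: tk)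
      then have "select (qualifies (restrict_oracle f ?X) (set (take m \<sigma>))) (drop m (take j \<sigma>)) =
          select ?Q (drop m (take j \<sigma>))"
        by (intro select_cong Q) auto
      moreover have "\<sigma> ! j \<in> ?X" by (simp add: tk)
      moreover have "last (take (Suc j) \<sigma>) = \<sigma> ! j" "butlast (take (Suc j) \<sigma>) = take j \<sigma>"
        by (simp_all add: tk)
      moreover have "m < length (take (Suc j) \<sigma>)" using True Suc.prems by simp
      ultimately have "?d j \<longleftrightarrow> ?Q (\<sigma> ! j) \<and> I (insert (\<sigma> ! j) (select ?Q (drop m (take j \<sigma>))))"
        unfolding decide_def Let_def tm using Q by simp
      then show ?thesis using Suc unfolding split dr by simp
    qed
  qed simp
  from this[of "length \<sigma>"] show ?thesis by (simp add: accepted_def)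
qed

lemma qualifies_iff:
  assumes "finite U" "inj_on rank U" "S \<subseteq> U" "u \<in> U"
  shows "qualifies f S u \<longleftrightarrow> u \<notin> S \<and> u \<in> elem ` set (trace f S {} U)"
  unfolding qualifies_def
  using trace_elem_restrict[of U "insert u S" S f "{}"] assms by auto

end

subsection \<open>Losses caused by the capacity constraints\<close>

text \<open>The exponents are distinct and positive, so this is a partial sum of the geometric
  series without its constant term.\<close>

lemma sum_power_le_geometric:
  fixes r :: real
  assumes "finite X" "0 \<notin> X" "0 \<le> r" "r < 1"
  shows "(\<Sum>m\<in>X. r ^ m) \<le> r / (1 - r)"
proof -
  have Suc: "Suc (m - 1) = m" if "m \<in> X" for m using that assms(2) by (cases m) auto
  have "inj_on (\<lambda>m. m - 1) X" by (rule inj_onI) (metis Suc)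
  then have "(\<Sum>m\<in>X. r ^ m) = (\<Sum>m\<in>(\<lambda>m. m - 1) ` X. r ^ Suc m)"
    by (simp only: sum.reindex) (simp only: comp_def Suc cong: sum.cong)
  also have "\<dots> \<le> (\<Sum>m. r ^ Suc m)"
    using assms by (intro sum_le_suminf) (auto simp: summable_mult)
  also have "\<dots> = r / (1 - r)"
    using assms by (simp add: suminf_mult suminf_geometric)
  finally show ?thesis .
qed

locale laminar_simulation = submodular_simulation I rank U f p k
  for I :: "'a set \<Rightarrow> bool" and rank U f p k +
  fixes Fs :: "nat \<Rightarrow> 'a set set" and mu :: "nat \<Rightarrow> 'a set \<Rightarrow> nat" and x :: real
  assumes I_iff: "I T \<longleftrightarrow> (\<forall>i<k. laminar_indep U (Fs i) (mu i) T)"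
    and laminar: "i < k \<Longrightarrow> laminar_family U (Fs i)"
    and inj_rank: "inj_on rank U"
    and x: "2 < x" "(1 - p) * x \<le> 1 / 2"
begin

text \<open>A tight set of a given capacity may be replaced by the largest member of the family with the
  same capacity, so it suffices to watch these. Members of equal capacity are then disjoint.\<close>
definition layer :: "nat \<Rightarrow> 'a set set" where
  "layer i = {B \<in> Fs i. 1 \<le> mu i B \<and> (\<forall>B'\<in>Fs i. B \<subseteq> B' \<and> mu i B' = mu i B \<longrightarrow> B' = B)}"

text \<open>For each watched set: the number of tails beyond its capacity, times a bound on the gain
  of each.\<close>

definition excess_loss :: "'a step list \<Rightarrow> real" where
  "excess_loss t = (\<Sum>i<k. \<Sum>B\<in>layer i. real (tail_count B t - mu i B) * first_gain B t)"

lemma I_empty: "I {}"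
  by (simp add: I_iff laminar_indep_def)

lemma finite_Fs: "i < k \<Longrightarrow> finite (Fs i)"
  using laminar finite_U finite_subset[of "Fs i" "Pow U"] by (auto simp: laminar_family_def)

lemma finite_layer: "i < k \<Longrightarrow> finite (layer i)"
  using finite_Fs by (simp add: layer_def)

lemma first_gain_nonneg: "0 \<le> first_gain B (trace f S {} U)"
proof -
  have "0 \<le> first_gain B t" if "\<forall>e\<in>set t. 0 \<le> gain e" for t
    using that by (induction t) auto
  then show ?thesis using gain_nonneg[OF finite_U order_refl] by blast
qed

lemma layer_covers:
  assumes "i < k" "B \<in> Fs i" "1 \<le> mu i B"
  obtains B' where "B' \<in> layer i" "B \<subseteq> B'" "mu i B' = mu i B"
proof -
  let ?\<B> = "{B' \<in> Fs i. mu i B' = mu i B}"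
  have "finite ?\<B>" "B \<in> ?\<B>" using assms finite_Fs by auto
  from finite_has_maximal2[OF this] obtain B' where
    B': "B' \<in> ?\<B>" "B \<subseteq> B'" "\<forall>C\<in>?\<B>. B' \<subseteq> C \<longrightarrow> B' = C" by blast
  then have "B' \<in> layer i" using assms(3) by (auto simp: layer_def)
  then show ?thesis using that B' by blast
qed

text \<open>A rejected tail lies in a set that \<open>A\<close> fills, and then in a layer member
  that \<open>A\<close> fills. Such a \<open>B\<close> leaves at most
  \<open>card (N \<inter> B) - mu i B\<close> tails to reject, each worth at most
  \<open>first_gain B t\<close>. Since gains are nonnegative, counting an element for several sets
  does no harm.\<close>

lemma rejected_gain_le:
  fixes S defines "t \<equiv> trace f S {} U"
  defines "N \<equiv> elem ` {e \<in> set t. \<not> heads e}"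
  assumes A: "A \<subseteq> N" "I A" "\<And>u. u \<in> N - A \<Longrightarrow> \<not> I (insert u A)"
  shows "(\<Sum>e\<leftarrow>filter (\<lambda>e. \<not> heads e \<and> elem e \<notin> A) t. gain e) \<le> excess_loss t"
proof -
  define E where "E = {e \<in> set t. \<not> heads e \<and> elem e \<notin> A}"
  define E' where "E' i B = {e \<in> E. elem e \<in> B \<and> mu i B \<le> card (A \<inter> B)}" for i B
  have dist: "distinct (map elem t)" unfolding t_def by (rule distinct_trace[OF finite_U])
  then have inj: "inj_on elem (set t)" and dt: "distinct t" by (auto simp: distinct_map)
  have props: "elem e \<in> U" "I (insert (elem e) (base e))" "0 \<le> gain e" if "e \<in> set t" for e
    using trace_step_props[OF finite_U order_refl, of e S "{}"]
      gain_nonneg[OF finite_U order_refl, of e S "{}"] that unfolding t_def by auto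
  have finE: "finite E" "\<And>i B. finite (E' i B)" by (auto simp: E_def E'_def)
  have finA: "finite A" using I_subset[OF A(2)] finite_U by (rule finite_subset)
  have tc: "tail_count B t = card (N \<inter> B)" for B
  proof -
    have "N \<inter> B = elem ` set (filter (\<lambda>e. \<not> heads e \<and> elem e \<in> B) t)" by (auto simp: N_def)
    also have "card \<dots> = card (set (filter (\<lambda>e. \<not> heads e \<and> elem e \<in> B) t))"
      using inj by (intro card_image) (auto intro: inj_on_subset)
    also have "\<dots> = tail_count B t" using dt by (simp only: tail_count_def distinct_card distinct_filter)
    finally show ?thesis by simp
  qed
  have covered: "\<exists>i<k. \<exists>B\<in>layer i. e \<in> E' i B" if e: "e \<in> E" for e
  proof -
    let ?u = "elem e"
    have u: "?u \<in> N - A" "?u \<in> U" "I (insert ?u (base e))"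
      using e props by (auto simp: E_def N_def)
    then have "insert ?u A \<subseteq> U" using I_subset[OF A(2)] by auto
    then obtain i B where i: "i < k" and B: "B \<in> Fs i" "mu i B < card (insert ?u A \<inter> B)"
      using A(3)[OF u(1)] by (auto simp: I_iff laminar_indep_def not_le)
    have AB: "card (A \<inter> B) \<le> mu i B" using A(2) i B by (simp add: I_iff laminar_indep_def)
    have uB: "?u \<in> B" using B(2) AB by (cases "?u \<in> B") auto
    then have "insert ?u A \<inter> B = insert ?u (A \<inter> B)" by auto
    then have full: "mu i B \<le> card (A \<inter> B)"
      using B(2) finA card_insert_le_m1[of "Suc (card (A \<inter> B))" "A \<inter> B" ?u] by simp
    \<comment> \<open>\<open>B\<close> has positive capacity, as the simulation found
      \<open>?u\<close> compatible with its state.\<close>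
    have "finite (insert ?u (base e))" using I_subset[OF u(3)] finite_U by (rule finite_subset)
    then have "card {?u} \<le> card (insert ?u (base e) \<inter> B)" using uB by (intro card_mono) auto
    also have "\<dots> \<le> mu i B" using u(3) i B(1) by (auto simp: I_iff laminar_indep_def)
    finally have "1 \<le> mu i B" by simp
    from layer_covers[OF i B(1) this] obtain B' where
      B': "B' \<in> layer i" "B \<subseteq> B'" "mu i B' = mu i B" .
    \<comment> \<open>Because the capacities are equal, the larger \<open>B'\<close> is full as
      well.\<close>
    have "card (A \<inter> B) \<le> card (A \<inter> B')" using B'(2) finA by (intro card_mono) auto
    then have "e \<in> E' i B'" using e uB B' full by (auto simp: E'_def)
    then show ?thesis using i B'(1) by blast
  qed
  have layer_le: "(\<Sum>e\<in>E' i B. gain e) \<le> real (tail_count B t - mu i B) * first_gain B t" for i B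
  proof -
    have "(\<Sum>e\<in>E' i B. gain e) \<le> real (card (E' i B)) * first_gain B t"
      by (rule sum_bounded_above)
        (auto simp: E'_def E_def t_def intro!: gain_le_first_gain finite_U)
    also have "\<dots> \<le> real (tail_count B t - mu i B) * first_gain B t"
    proof (intro mult_right_mono of_nat_mono)
      show "0 \<le> first_gain B t" unfolding t_def by (rule first_gain_nonneg)
      show "card (E' i B) \<le> tail_count B t - mu i B"
      proof (cases "E' i B = {}")
        case False
        then have full: "mu i B \<le> card (A \<inter> B)" by (auto simp: E'_def)
        have "card (E' i B) = card (elem ` E' i B)"
          using inj by (intro card_image[symmetric]) (auto simp: E'_def E_def intro: inj_on_subset)
        also have "\<dots> \<le> card (N \<inter> B - A \<inter> B)"
          by (rule card_mono) (auto simp: N_def E'_def E_def)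
        also have "\<dots> = card (N \<inter> B) - card (A \<inter> B)"
          using A(1) finA by (intro card_Diff_subset) auto
        finally show ?thesis using full tc by simp
      qed simp
    qed
    finally show ?thesis .
  qed
  let ?P = "Sigma {..<k} layer"
  have finP: "finite ?P" using finite_layer by auto
  have "(\<Sum>e\<leftarrow>filter (\<lambda>e. \<not> heads e \<and> elem e \<notin> A) t. gain e) = (\<Sum>e\<in>E. gain e)"
    using dt by (subst sum_list_distinct_conv_sum_set) (auto simp: E_def)
  also have "\<dots> \<le> (\<Sum>e\<in>E. \<Sum>(i, B)\<in>?P. if e \<in> E' i B then gain e else 0)"
  proof (rule sum_mono)
    fix e assume e: "e \<in> E"
    then obtain i B where "i < k" "B \<in> layer i" and iB: "e \<in> E' i B" using covered by blast
    then have iBP: "(i, B) \<in> ?P" by simp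
    have g: "0 \<le> gain e" using e props by (auto simp: E_def)
    have "gain e = (\<Sum>(i, B)\<in>{(i, B)}. if e \<in> E' i B then gain e else 0)" using iB by simp
    also have "\<dots> \<le> (\<Sum>(i, B)\<in>?P. if e \<in> E' i B then gain e else 0)"
      using finP iBP g by (intro sum_mono2) (auto split: if_splits)
    finally show "gain e \<le> (\<Sum>(i, B)\<in>?P. if e \<in> E' i B then gain e else 0)" .
  qed
  also have "\<dots> = (\<Sum>(i, B)\<in>?P. \<Sum>e\<in>E. if e \<in> E' i B then gain e else 0)"
    by (subst sum.swap) (simp add: case_prod_unfold)
  also have "\<dots> = (\<Sum>(i, B)\<in>?P. \<Sum>e\<in>E' i B. gain e)"
  proof (intro sum.cong refl, clarify)
    fix i B
    have "{e \<in> E. e \<in> E' i B} = E' i B" by (auto simp: E'_def)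
    then show "(\<Sum>e\<in>E. if e \<in> E' i B then gain e else 0) = (\<Sum>e\<in>E' i B. gain e)"
      using finE(1) by (simp flip: sum.inter_filter)
  qed
  also have "\<dots> \<le> (\<Sum>(i, B)\<in>?P. real (tail_count B t - mu i B) * first_gain B t)"
    using layer_le by (intro sum_mono) auto
  also have "\<dots> = excess_loss t"
    unfolding excess_loss_def using finite_layer by (subst sum.Sigma) auto
  finally show ?thesis .
qed

text \<open>Members through a common \<open>u\<close> are nested, and the layer keeps only those
  maximal for their capacity.\<close>

lemma layer_capacity_inj:
  assumes "i < k"
  shows "inj_on (mu i) {B \<in> layer i. u \<in> B}"
proof (rule inj_onI)
  fix B C assume B: "B \<in> {B \<in> layer i. u \<in> B}" and C: "C \<in> {B \<in> layer i. u \<in> B}"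
    and eq: "mu i B = mu i C"
  then have "B \<subseteq> C \<or> C \<subseteq> B"
    using laminar[OF assms] unfolding laminar_family_def layer_def by blast
  then show "B = C" using B C eq by (auto simp: layer_def)
qed

text \<open>These are the coefficients of the excess bound for \<open>y = 2\<close>. The capacities
  of the layer members through \<open>u\<close> are distinct and positive, so a geometric series of
  ratio \<open>2 / x\<close> dominates.\<close>

lemma sum_layer_coeff_le:
  assumes "i < k"
  shows "(\<Sum>B | B \<in> layer i \<and> u \<in> B. 2 ^ mu i B / (x ^ Suc (mu i B) * p)) \<le> 2 / (x * (x - 2) * p)"
proof -
  let ?L = "{B \<in> layer i. u \<in> B}"
  have "(\<Sum>B\<in>?L. 2 ^ mu i B / (x ^ Suc (mu i B) * p)) = (\<Sum>B\<in>?L. (2 / x) ^ mu i B) / (x * p)"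
    unfolding sum_divide_distrib by (intro sum.cong refl) (simp add: power_divide)
  also have "(\<Sum>B\<in>?L. (2 / x) ^ mu i B) = (\<Sum>m\<in>mu i ` ?L. (2 / x) ^ m)"
    using layer_capacity_inj[OF assms] by (subst sum.reindex) auto
  also have "\<dots> \<le> (2 / x) / (1 - 2 / x)"
  proof (rule sum_power_le_geometric)
    show "finite (mu i ` ?L)" using finite_layer[OF assms] by simp
    show "0 \<notin> mu i ` ?L" by (auto simp: layer_def)
  qed (use x in auto)
  also have "(2 / x) / (1 - 2 / x) = 2 / (x - 2)" using x by (simp add: field_simps)
  finally show ?thesis using x p by (simp add: divide_right_mono field_simps)
qed

lemma expect_excess_loss_le:
  "expect p f {} U excess_loss \<le>
    real k * (2 / (x * (x - 2) * p)) * expect p f {} U (head_gain UNIV)"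
proof -
  let ?E = "expect p f {} U"
  have "?E excess_loss =
      (\<Sum>i<k. \<Sum>B\<in>layer i. ?E (\<lambda>t. real (tail_count B t - mu i B) * first_gain B t))"
    unfolding excess_loss_def expect_def bernoulli_sum_sum ..
  also have "\<dots> \<le> (\<Sum>i<k. 2 / (x * (x - 2) * p) * ?E (head_gain UNIV))"
  proof (rule sum_mono)
    fix i assume "i \<in> {..<k}"
    then have i: "i < k" by simp
    have "(\<Sum>B\<in>layer i. ?E (\<lambda>t. real (tail_count B t - mu i B) * first_gain B t)) \<le>
        (\<Sum>B\<in>layer i. 2 ^ mu i B / (x ^ Suc (mu i B) * p) * ?E (head_gain B))"
    proof (rule sum_mono)
      fix B assume B: "B \<in> layer i"
      then have "card (T \<inter> B) \<le> mu i B" if "I T" for T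
        using that i by (auto simp: I_iff laminar_indep_def layer_def)
      \<comment> \<open>The choice \<open>y = 2\<close> is admissible:
        \<open>p / 2 + (1 - p) * x\<close> is at most \<open>1 / 2 + 1 / 2\<close>.\<close>
      then show "?E (\<lambda>t. real (tail_count B t - mu i B) * first_gain B t) \<le>
          2 ^ mu i B / (x ^ Suc (mu i B) * p) * ?E (head_gain B)"
        using x p I_empty finite_U by (intro expect_excess_first_gain_le) auto
    qed
    also have "\<dots> = ?E (\<lambda>t. \<Sum>B\<in>layer i. 2 ^ mu i B / (x ^ Suc (mu i B) * p) * head_gain B t)"
      unfolding expect_def bernoulli_sum_sum bernoulli_sum_cmult ..
    also have "\<dots> \<le> ?E (\<lambda>t. 2 / (x * (x - 2) * p) * head_gain UNIV t)"
      using p gain_nonneg[OF finite_U order_refl]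
      by (intro expect_mono weighted_head_gain_le finite_layer i sum_layer_coeff_le) auto
    also have "\<dots> = 2 / (x * (x - 2) * p) * ?E (head_gain UNIV)" by (rule expect_cmult)
    finally show "(\<Sum>B\<in>layer i. ?E (\<lambda>t. real (tail_count B t - mu i B) * first_gain B t)) \<le>
      2 / (x * (x - 2) * p) * ?E (head_gain UNIV)" .
  qed
  finally show ?thesis by simp
qed

text \<open>This holds pointwise, for every order and sample size: the accepted set is a maximal
  independent selection among the tails, so \<open>rejected_gain_le\<close> bounds what it
  misses.\<close>

lemma accepted_value_ge:
  fixes m :: nat
  assumes "\<sigma> \<in> permutations_of_set U"
  defines "S \<equiv> set (take m \<sigma>)"
  shows "f {} + tail_fresh_gain (trace f S {} U) - excess_loss (trace f S {} U) \<le>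
    f (accepted (decide m) f \<sigma>)"
proof -
  have \<sigma>: "set \<sigma> = U" "distinct \<sigma>" using assms by (auto simp: permutations_of_set_def)
  let ?t = "trace f S {} U"
  let ?A = "select (qualifies f S) (drop m \<sigma>)"
  let ?N = "elem ` {e \<in> set ?t. \<not> heads e}"
  have SU: "S \<subseteq> U" using \<sigma> by (auto simp: S_def dest: in_set_takeD)
  have "set \<sigma> = S \<union> set (drop m \<sigma>)" unfolding S_def by (metis append_take_drop_id set_append)
  moreover have "S \<inter> set (drop m \<sigma>) = {}"
    unfolding S_def using \<sigma>(2) by (simp add: set_take_disj_set_drop_if_distinct)
  ultimately have drop: "set (drop m \<sigma>) = U - S" using \<sigma>(1) by auto
  have qual: "qualifies f S u \<longleftrightarrow> u \<in> ?N" if "u \<in> U" for u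
    using that SU inj_rank trace_heads[OF finite_U, of _ f S "{}"]
    by (auto simp: qualifies_iff[OF finite_U])
  have N: "?N \<subseteq> U - S"
    using trace_elem_remaining[OF finite_U, of f S "{}"] trace_heads[OF finite_U, of _ f S "{}"] by auto
  have A: "?A \<subseteq> ?N" using select_subset[of "qualifies f S" "drop m \<sigma>"] drop qual by auto
  have "\<not> I (insert u ?A)" if "u \<in> ?N - ?A" for u
    by (rule select_maximal) (use that N qual drop I_down in auto)
  then have "(\<Sum>e\<leftarrow>filter (\<lambda>e. \<not> heads e \<and> elem e \<notin> ?A) ?t. gain e) \<le> excess_loss ?t"
    using A select_indep[OF I_empty] by (intro rejected_gain_le)
  moreover have "f {} + tail_fresh_gain ?t -
      (\<Sum>e\<leftarrow>filter (\<lambda>e. \<not> heads e \<and> elem e \<notin> ?A) ?t. gain e) \<le> f ?A"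
    using A N by (intro value_ge_tail_fresh_gain) auto
  ultimately show ?thesis by (simp add: accepted_decide S_def)
qed

lemma accepted_indep: "I (accepted (decide m) f \<sigma>)"
  unfolding accepted_decide by (rule select_indep[OF I_empty])

lemma expectation_accepted_ge:
  assumes T: "I T"
    and \<kappa>: "0 \<le> \<kappa>" "\<kappa> \<le> 1" "\<kappa> \<le> 1 - p - real k * (2 / (x * (x - 2) * p))"
  shows "\<kappa> / (real k + 1) * f T \<le>
    measure_pmf.expectation
      (pair_pmf (binomial_pmf (card U) p) (pmf_of_set (permutations_of_set U)))
      (\<lambda>(m, \<sigma>). f (accepted (decide m) f \<sigma>))"
proof -
  let ?P = "pair_pmf (binomial_pmf (card U) p) (pmf_of_set (permutations_of_set U))"
  let ?E = "expect p f {} U"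
  let ?H = "?E (head_gain UNIV)"
  let ?\<Psi> = "\<lambda>t. f {} + tail_fresh_gain t - excess_loss t"
  have fin: "finite (set_pmf ?P)" and supp: "set_pmf ?P \<subseteq> UNIV \<times> permutations_of_set U"
    using finite_U p by (auto simp: set_pmf_binomial_eq)
  have opt: "f T - f {} \<le> (real k + 1) * ?H"
    using opt_le_head_gain[OF finite_U order_refl, of "{}" T] I_subset[OF T] T by simp
  have H: "0 \<le> ?H" by (rule expect_head_gain_nonneg[OF finite_U order_refl])
  have f0: "0 \<le> f {}" using mono_submodD(1)[OF submod] by simp
  have "\<kappa> / (real k + 1) * f T \<le> \<kappa> / (real k + 1) * (f {} + (real k + 1) * ?H)"
    using opt \<kappa>(1) by (intro mult_left_mono) auto
  also have "\<dots> = \<kappa> / (real k + 1) * f {} + \<kappa> * ?H" by (simp add: field_simps)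
  \<comment> \<open>As \<open>f {}\<close> may be positive it is carried along;
    \<open>\<kappa> \<le> 1\<close> absorbs its share.\<close>
  also have "\<dots> \<le> 1 * f {} + (1 - p - real k * (2 / (x * (x - 2) * p))) * ?H"
    using \<kappa> f0 H by (intro add_mono mult_right_mono) auto
  also have "\<dots> = f {} + (1 - p) * (?H + f {} - f (U - U)) -
      real k * (2 / (x * (x - 2) * p)) * ?H"
    by (simp add: algebra_simps)
  also have "\<dots> \<le> f {} + ?E tail_fresh_gain - ?E excess_loss"
    using tail_fresh_gain_ge[OF finite_U order_refl, of "{}"] expect_excess_loss_le by simp
  also have "\<dots> = ?E ?\<Psi>"
    using finite_U by (simp add: expect_def bernoulli_sum_diff bernoulli_sum_add bernoulli_sum_const)
  \<comment> \<open>The independent coins are realized by the first \<open>m\<close>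
    arrivals.\<close>
  also have "\<dots> = measure_pmf.expectation ?P (\<lambda>(m, \<sigma>). ?\<Psi> (trace f (set (take m \<sigma>)) {} U))"
    unfolding expect_def using p by (intro expectation_binomial_prefix[symmetric] finite_U) auto
  also have "\<dots> \<le> measure_pmf.expectation ?P (\<lambda>(m, \<sigma>). f (accepted (decide m) f \<sigma>))"
    using fin supp accepted_value_ge
    by (intro integral_mono_AE integrable_measure_pmf_finite) (auto simp: AE_measure_pmf_iff)
  finally show ?thesis .
qed

end

subsection \<open>The competitive ratio\<close>

theorem theorem2:
  fixes k :: nat
  assumes "k \<ge> 1"
  shows "\<forall>(U :: 'a set) (Fs :: nat \<Rightarrow> 'a set set) (mu :: nat \<Rightarrow> 'a set \<Rightarrow> nat).
    finite U \<and> (\<forall>i<k. laminar_family U (Fs i)) \<longrightarrow>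
    (\<exists>P :: ('a list \<Rightarrow> ('a set \<Rightarrow> real) \<Rightarrow> bool) pmf.
       \<forall>f. mono_submod U f \<longrightarrow>
         (\<forall>d\<in>set_pmf P. \<forall>\<sigma>\<in>permutations_of_set U.
            \<forall>i<k. laminar_indep U (Fs i) (mu i) (accepted d f \<sigma>)) \<and>
         measure_pmf.expectation (pair_pmf P (pmf_of_set (permutations_of_set U)))
             (\<lambda>(d, \<sigma>). f (accepted d f \<sigma>))
           \<ge> 9 / (1000 * real k * (real k + 1)) *
             Max (f ` {T. \<forall>i<k. laminar_indep U (Fs i) (mu i) T}))"
proof (intro allI impI)
  fix U :: "'a set" and Fs :: "nat \<Rightarrow> 'a set set" and mu :: "nat \<Rightarrow> 'a set \<Rightarrow> nat"
  assume asm: "finite U \<and> (\<forall>i<k. laminar_family U (Fs i))"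
  then have fin: "finite U" and lam: "\<forall>i<k. laminar_family U (Fs i)" by auto
  define I where "I T \<longleftrightarrow> (\<forall>i<k. laminar_indep U (Fs i) (mu i) T)" for T
  obtain rank :: "'a \<Rightarrow> nat" where rank: "inj_on rank U"
    using finite_imp_inj_to_nat_seg[OF fin] by blast
  \<comment> \<open>With these values \<open>(1 - p) * x\<close> is exactly \<open>1 / 2\<close>.
    Tails bring in \<open>1 / (50 * real k)\<close> of the head gain and the losses take less than
    \<open>1 / (281 * real k)\<close> of it, which leaves more than \<open>\<kappa>\<close>.\<close>
  define p where "p = 1 - 1 / (50 * real k)"
  define x where "x = 25 * real k"
  define \<kappa> where "\<kappa> = 9 / (1000 * real k)"
  have k: "1 \<le> real k" using assms by simp
  have p_bounds: "49 / 50 \<le> p" "p \<le> 1" using k by (auto simp: p_def field_simps)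
  \<comment> \<open>Here \<open>k \<ge> 1\<close> enters: inclusion in \<open>U\<close> is part of
    independence in at least one matroid.\<close>
  have I_sub: "T \<subseteq> U" if "I T" for T
    using that assms unfolding I_def laminar_indep_def by (metis less_eq_Suc_le One_nat_def)
  have sim: "laminar_simulation I rank U f p k Fs mu x" if f: "mono_submod U f" for f
  proof
    show "I T'" if "I T" "T' \<subseteq> T" for T T'
      using that fin laminar_indep_subset unfolding I_def by metis
    show "\<exists>X\<subseteq>T. card X \<le> k \<and> I (insert u M \<union> (T - X))" if "I (M \<union> T)" "I (insert u M)" for M T u
      using laminar_intersection_exchange[OF fin lam] that unfolding I_def by blast
    have "1 \<le> 49 / 50 * (1 + 1 :: real)" by simp
    also have "\<dots> \<le> p * (real k + 1)" using p_bounds k by (intro mult_mono) auto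
    finally show "1 \<le> p * (real k + 1)" .
    show "(1 - p) * x \<le> 1 / 2" using k by (simp add: p_def x_def)
    show "0 < p" "p \<le> 1" using p_bounds by auto
    show "2 < x" using k by (simp add: x_def)
    show "laminar_family U (Fs i)" if "i < k" for i using lam that by blast
    show "T \<subseteq> U" if "I T" for T using that by (rule I_sub)
    show "I T \<longleftrightarrow> (\<forall>i<k. laminar_indep U (Fs i) (mu i) T)" for T by (rule I_def)
    show "finite U" by (rule fin)
    show "mono_submod U f" by (rule f)
    show "inj_on rank U" by (rule rank)
  qed
  interpret simulated_greedy I rank .
  \<comment> \<open>The only random choice of the algorithm is the sample size; the rule is built
    from \<open>I\<close> and \<open>rank\<close> before \<open>f\<close> is fixed.\<close>
  let ?P = "map_pmf decide (binomial_pmf (card U) p)"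
  show "\<exists>P :: ('a list \<Rightarrow> ('a set \<Rightarrow> real) \<Rightarrow> bool) pmf.
       \<forall>f. mono_submod U f \<longrightarrow>
         (\<forall>d\<in>set_pmf P. \<forall>\<sigma>\<in>permutations_of_set U.
            \<forall>i<k. laminar_indep U (Fs i) (mu i) (accepted d f \<sigma>)) \<and>
         measure_pmf.expectation (pair_pmf P (pmf_of_set (permutations_of_set U)))
             (\<lambda>(d, \<sigma>). f (accepted d f \<sigma>))
           \<ge> 9 / (1000 * real k * (real k + 1)) *
             Max (f ` {T. \<forall>i<k. laminar_indep U (Fs i) (mu i) T})"
  proof (intro exI[of _ ?P] allI impI conjI)
    fix f assume f: "mono_submod U f"
    interpret laminar_simulation I rank U f p k Fs mu x by (rule sim[OF f])
    show "\<forall>d\<in>set_pmf ?P. \<forall>\<sigma>\<in>permutations_of_set U.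
        \<forall>i<k. laminar_indep U (Fs i) (mu i) (accepted d f \<sigma>)"
      using accepted_indep by (auto simp: I_def)
    have "{T. I T} \<subseteq> Pow U" using I_sub by auto
    then have "finite {T. I T}" using fin by (simp add: finite_subset)
    then have "Max (f ` {T. I T}) \<in> f ` {T. I T}" using I_empty by (intro Max_in) auto
    then obtain T where T: "I T" "Max (f ` {T. I T}) = f T" by auto
    \<comment> \<open>Since \<open>k \<ge> 1\<close>, \<open>x - 2\<close> is at least
      \<open>23 * real k\<close>.\<close>
    have "25 * real k * (23 * real k) * (49 / 50) \<le> x * (x - 2) * p"
      using k p_bounds by (intro mult_mono) (auto simp: x_def)
    moreover have "0 < 25 * real k * (23 * real k) * (49 / 50)" using k by simp
    ultimately have "2 / (x * (x - 2) * p) \<le> 2 / (25 * real k * (23 * real k) * (49 / 50))"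
      by (intro frac_le) auto
    then have "real k * (2 / (x * (x - 2) * p)) \<le>
        real k * (2 / (25 * real k * (23 * real k) * (49 / 50)))"
      by (intro mult_left_mono) auto
    also have "\<dots> \<le> 1 / (50 * real k) - \<kappa>" using k by (simp add: \<kappa>_def field_simps)
    finally have \<kappa>: "\<kappa> \<le> 1 - p - real k * (2 / (x * (x - 2) * p))" by (simp add: p_def)
    have "9 / (1000 * real k * (real k + 1)) * Max (f ` {T. I T}) = \<kappa> / (real k + 1) * f T"
      by (simp add: \<kappa>_def T)
    also have "\<dots> \<le> measure_pmf.expectation
        (pair_pmf (binomial_pmf (card U) p) (pmf_of_set (permutations_of_set U)))
        (\<lambda>(m, \<sigma>). f (accepted (decide m) f \<sigma>))"
      using T(1) \<kappa> k by (intro expectation_accepted_ge) (auto simp: \<kappa>_def field_simps)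
    also have "\<dots> = measure_pmf.expectation (pair_pmf ?P (pmf_of_set (permutations_of_set U)))
        (\<lambda>(d, \<sigma>). f (accepted d f \<sigma>))"
      by (simp add: pair_map_pmf1 case_prod_unfold apfst_def)
    finally show "9 / (1000 * real k * (real k + 1)) *
        Max (f ` {T. \<forall>i<k. laminar_indep U (Fs i) (mu i) T}) \<le>
        measure_pmf.expectation (pair_pmf ?P (pmf_of_set (permutations_of_set U)))
        (\<lambda>(d, \<sigma>). f (accepted d f \<sigma>))" unfolding I_def .
  qed
qed

end
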